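(* Let $\mathbb{X}$ be a distributive restriction category. Then $\mathbb{X}$ is a classical restriction category if and only if $\mathbb{X}$ has classical products.
   Context: Composition is written in diagrammatic order: for $f:A\to B$ and $g:B\to C$, $fg:A\to C$ is first $f$, then $g$. **Restriction categories.** A restriction category is a category $\mathbb{X}$ with an operator assigning to each map $f:A\to B$ a map $\overline{f}:A\to A$ such that (whenever the expressions are well-typed) [R.1] $\overline{f}f=f$; [R.2] $\overline{f}\,\overline{g}=\overline{g}\,\overline{f}$; [R.3] $\overline{\overline{g}f}=\overline{g}\,\overline{f}$; [R.4] $f\overline{g}=\overline{fg}f$. A map $f:A\to B$ is total if $\overline{f}=1_A$. $\mathbb{X}$ has restriction zeroes if it has zero maps $0:A\to B$ for all $A,B$ (so $f0=0=0f$ for all $f$) and $\overline{0}=0$. **Distributive restriction categories.** A Cartesian restriction category is a restriction category with (a) a restriction terminal object: an object $\mathsf{1}$ such that for each $A$ there is a unique total map $t_A:A\to\mathsf{1}$, and $f t_B=\overline{f}t_A$ for every $f:A\to B$; and (b) binary restriction products: for all $A,B$ an object $A\times B$ with total maps $\pi_0:A\times B\to A$, $\pi_1:A\times B\to B$ such that for all $f:C\to A$, $g:C\to B$ there is a unique $\langle f,g\rangle:C\to A\times B$ with $\langle f,g\rangle\pi_0=\overline{g}f$ and $\langle f,g\rangle\pi_1=\overline{f}g$. A coCartesian restriction category is a restriction category with finite coproducts $\oplus$ (initial object $\mathsf{0}$ with unique maps $z_A:\mathsf{0}\to A$, injections $\iota_j$, copairing $[-,\dots,-]$) whose injections are all total.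 A distributive restriction category is a restriction category that is both Cartesian and coCartesian and such that the canonical maps $[1_A\times\iota_0,\,1_A\times\iota_1]:(A\times B)\oplus(A\times C)\to A\times(B\oplus C)$ and $\langle z_A,1_{\mathsf{0}}\rangle:\mathsf{0}\to A\times\mathsf{0}$ are isomorphisms, where $1_A\times h=\langle\pi_0,\pi_1h\rangle$. **Classical products.** A distributive restriction category has classical products if it has restriction zeroes and, for all objects $A,B$, the object $A\& B:=A\oplus B\oplus(A\times B)$ with the maps $p_0:=[1_A,0,\pi_0]:A\& B\to A$ and $p_1:=[0,1_B,\pi_1]:A\& B\to B$ is a (genuine categorical) product of $A$ and $B$. **Classical restriction categories.** For parallel $f,g:A\to B$ in a restriction category: $f\le g$ means $\overline{f}g=f$; $f\smile g$ (compatible) means $\overline{f}g=\overline{g}f$; if there are restriction zeroes, $f\perp g$ (disjoint) means $\overline{f}g=0$. The join of a finite family of pairwise compatible parallel maps $f_0,\dots,f_n:A\to B$ is their least upper bound $f_0\vee\dots\vee f_n$ with respect to $\le$. A join restriction category is a restriction category in which every finite (possibly empty) pairwise compatible family of parallel maps has a join and joins are preserved by precomposition: $h(f_0\vee\dots\vee f_n)=hf_0\vee\dots\vee hf_n$. (Such a category has restriction zeroes, given by empty joins.) A classical restriction category is a join restriction category in which for all parallel $f\le g$ there is a (necessarily unique) map $g\backslash f$ (the relative complement) with $g\backslash f\perp f$ and $g\backslash f\vee f=g$. *)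

theory Defs
  imports Main
begin

text \<open>
  A category is given by sets of objects and arrows, every arrow carrying its domain and codomain.
  Composition is diagrammatic: \<open>f \<cdot> g\<close> is first \<open>f\<close>, then \<open>g\<close>.
  \<open>\<rho> f\<close> is the restriction of \<open>f\<close> (an overline on paper).
\<close>

record ('o, 'm) restriction_structure =
  Ob :: "'o set"
  Arr :: "'m set"
  Dom :: "'m \<Rightarrow> 'o"
  Cod :: "'m \<Rightarrow> 'o"
  Ident :: "'o \<Rightarrow> 'm" ("\<one>\<index>")
  Comp :: "'m \<Rightarrow> 'm \<Rightarrow> 'm" (infixl "\<cdot>\<index>" 70)
  Restr :: "'m \<Rightarrow> 'm" ("\<rho>\<index> _" [81] 80)

definition hom :: "('o, 'm, 'x) restriction_structure_scheme \<Rightarrow> 'o \<Rightarrow> 'o \<Rightarrow> 'm set" where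
  "hom X A B = {f \<in> Arr X. Dom X f = A \<and> Cod X f = B}"

locale category =
  fixes X :: "('o, 'm, 'x) restriction_structure_scheme" (structure)
  assumes Dom_Ob: "f \<in> Arr X \<Longrightarrow> Dom X f \<in> Ob X"
    and Cod_Ob: "f \<in> Arr X \<Longrightarrow> Cod X f \<in> Ob X"
    and Ident_hom: "A \<in> Ob X \<Longrightarrow> \<one> A \<in> hom X A A"
    and Comp_hom: "f \<in> hom X A B \<Longrightarrow> g \<in> hom X B C \<Longrightarrow> f \<cdot> g \<in> hom X A C"
    and Ident_left: "f \<in> hom X A B \<Longrightarrow> \<one> A \<cdot> f = f"
    and Ident_right: "f \<in> hom X A B \<Longrightarrow> f \<cdot> \<one> B = f"
    and Comp_assoc: "f \<in> hom X A B \<Longrightarrow> g \<in> hom X B C \<Longrightarrow> h \<in> hom X C D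
      \<Longrightarrow> (f \<cdot> g) \<cdot> h = f \<cdot> (g \<cdot> h)"

definition iso_arr :: "('o, 'm, 'x) restriction_structure_scheme \<Rightarrow> 'o \<Rightarrow> 'o \<Rightarrow> 'm \<Rightarrow> bool" where
  "iso_arr X A B f \<longleftrightarrow> f \<in> hom X A B \<and>
     (\<exists>g \<in> hom X B A. f \<cdot>\<^bsub>X\<^esub> g = \<one>\<^bsub>X\<^esub> A \<and> g \<cdot>\<^bsub>X\<^esub> f = \<one>\<^bsub>X\<^esub> B)"

definition is_product ::
  "('o, 'm, 'x) restriction_structure_scheme \<Rightarrow> 'o \<Rightarrow> 'o \<Rightarrow> 'o \<Rightarrow> 'm \<Rightarrow> 'm \<Rightarrow> bool" where
  "is_product X A B P p q \<longleftrightarrow>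
     P \<in> Ob X \<and> p \<in> hom X P A \<and> q \<in> hom X P B \<and>
     (\<forall>C \<in> Ob X. \<forall>f \<in> hom X C A. \<forall>g \<in> hom X C B.
        \<exists>!h. h \<in> hom X C P \<and> h \<cdot>\<^bsub>X\<^esub> p = f \<and> h \<cdot>\<^bsub>X\<^esub> q = g)"


subsection \<open>Restriction categories\<close>

locale restriction_category = category +
  assumes Restr_hom: "f \<in> hom X A B \<Longrightarrow> \<rho> f \<in> hom X A A"
    and R1: "f \<in> hom X A B \<Longrightarrow> \<rho> f \<cdot> f = f"
    and R2: "f \<in> hom X A B \<Longrightarrow> g \<in> hom X A C \<Longrightarrow> \<rho> f \<cdot> \<rho> g = \<rho> g \<cdot> \<rho> f"
    and R3: "f \<in> hom X A B \<Longrightarrow> g \<in> hom X A C \<Longrightarrow> \<rho> (\<rho> g \<cdot> f) = \<rho> g \<cdot> \<rho> f"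
    and R4: "f \<in> hom X A B \<Longrightarrow> g \<in> hom X B C \<Longrightarrow> f \<cdot> \<rho> g = \<rho> (f \<cdot> g) \<cdot> f"

definition total :: "('o, 'm, 'x) restriction_structure_scheme \<Rightarrow> 'm \<Rightarrow> bool" where
  "total X f \<longleftrightarrow> \<rho>\<^bsub>X\<^esub> f = \<one>\<^bsub>X\<^esub> (Dom X f)"

definition restriction_zeroes ::
  "('o, 'm, 'x) restriction_structure_scheme \<Rightarrow> ('o \<Rightarrow> 'o \<Rightarrow> 'm) \<Rightarrow> bool" where
  "restriction_zeroes X Z \<longleftrightarrow>
     (\<forall>A \<in> Ob X. \<forall>B \<in> Ob X. Z A B \<in> hom X A B) \<and>
     (\<forall>A \<in> Ob X. \<forall>B \<in> Ob X. \<forall>C \<in> Ob X. \<forall>f \<in> hom X A B.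
        f \<cdot>\<^bsub>X\<^esub> Z B C = Z A C \<and> Z C A \<cdot>\<^bsub>X\<^esub> f = Z C B) \<and>
     (\<forall>A \<in> Ob X. \<forall>B \<in> Ob X. \<rho>\<^bsub>X\<^esub> (Z A B) = Z A A)"

definition has_restriction_zeroes :: "('o, 'm, 'x) restriction_structure_scheme \<Rightarrow> bool" where
  "has_restriction_zeroes X \<longleftrightarrow> (\<exists>Z. restriction_zeroes X Z)"

text \<open>
  A family of restriction zeroes is determined on the objects of \<open>X\<close>. Hence if
  \<open>has_restriction_zeroes X\<close>, then \<open>zero_arr X A B\<close> is well defined for all objects \<open>A\<close>, \<open>B\<close>;
  otherwise it is meaningless.
\<close>

definition zero_arr :: "('o, 'm, 'x) restriction_structure_scheme \<Rightarrow> 'o \<Rightarrow> 'o \<Rightarrow> 'm" where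
  "zero_arr X A B = (THE z. \<exists>Z. restriction_zeroes X Z \<and> z = Z A B)"


subsection \<open>Classical restriction categories\<close>

text \<open>The following relations are only meant for parallel arrows.\<close>

definition restr_le :: "('o, 'm, 'x) restriction_structure_scheme \<Rightarrow> 'm \<Rightarrow> 'm \<Rightarrow> bool" where
  "restr_le X f g \<longleftrightarrow> \<rho>\<^bsub>X\<^esub> f \<cdot>\<^bsub>X\<^esub> g = f"

definition compatible :: "('o, 'm, 'x) restriction_structure_scheme \<Rightarrow> 'm \<Rightarrow> 'm \<Rightarrow> bool" where
  "compatible X f g \<longleftrightarrow> \<rho>\<^bsub>X\<^esub> f \<cdot>\<^bsub>X\<^esub> g = \<rho>\<^bsub>X\<^esub> g \<cdot>\<^bsub>X\<^esub> f"

definition disjoint_arr :: "('o, 'm, 'x) restriction_structure_scheme \<Rightarrow> 'm \<Rightarrow> 'm \<Rightarrow> bool" where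
  "disjoint_arr X f g \<longleftrightarrow> \<rho>\<^bsub>X\<^esub> f \<cdot>\<^bsub>X\<^esub> g = zero_arr X (Dom X f) (Cod X g)"

definition is_join ::
  "('o, 'm, 'x) restriction_structure_scheme \<Rightarrow> 'o \<Rightarrow> 'o \<Rightarrow> 'm set \<Rightarrow> 'm \<Rightarrow> bool" where
  "is_join X A B F j \<longleftrightarrow>
     j \<in> hom X A B \<and>
     (\<forall>f \<in> F. restr_le X f j) \<and>
     (\<forall>k \<in> hom X A B. (\<forall>f \<in> F. restr_le X f k) \<longrightarrow> restr_le X j k)"

locale join_restriction_category = restriction_category +
  assumes join_exists:
      "\<lbrakk>A \<in> Ob X; B \<in> Ob X; F \<subseteq> hom X A B; finite F;
        \<And>f g. f \<in> F \<Longrightarrow> g \<in> F \<Longrightarrow> compatible X f g\<rbrakk> \<Longrightarrow> \<exists>j. is_join X A B F j"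
    and join_precomp:
      "\<lbrakk>A \<in> Ob X; B \<in> Ob X; F \<subseteq> hom X A B; finite F;
        \<And>f g. f \<in> F \<Longrightarrow> g \<in> F \<Longrightarrow> compatible X f g;
        is_join X A B F j; h \<in> hom X C A\<rbrakk> \<Longrightarrow> is_join X C B ((\<lambda>f. h \<cdot> f) ` F) (h \<cdot> j)"

text \<open>
  A join restriction category has restriction zeroes (the empty joins), so that
  \<open>disjoint_arr\<close> is meaningful below.
\<close>

locale classical_restriction_category = join_restriction_category +
  assumes relative_complement:
      "\<lbrakk>f \<in> hom X A B; g \<in> hom X A B; restr_le X f g\<rbrakk>
        \<Longrightarrow> \<exists>d \<in> hom X A B. disjoint_arr X d f \<and> is_join X A B {d, f} g"


subsection \<open>Distributive restriction categories\<close>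

text \<open>
  Restriction products and coproducts are chosen structure: a (restriction) terminal object,
  binary (restriction) products, an initial object and binary coproducts.
\<close>

record ('o, 'm) distributive_structure = "('o, 'm) restriction_structure" +
  Terminal :: "'o"
  ProdOb :: "'o \<Rightarrow> 'o \<Rightarrow> 'o" (infixr "\<otimes>\<index>" 75)
  Proj0 :: "'o \<Rightarrow> 'o \<Rightarrow> 'm"
  Proj1 :: "'o \<Rightarrow> 'o \<Rightarrow> 'm"
  Initial :: "'o"
  SumOb :: "'o \<Rightarrow> 'o \<Rightarrow> 'o" (infixl "\<oplus>\<index>" 65)
  Inj0 :: "'o \<Rightarrow> 'o \<Rightarrow> 'm"
  Inj1 :: "'o \<Rightarrow> 'o \<Rightarrow> 'm"

definition to_terminal :: "('o, 'm, 'x) distributive_structure_scheme \<Rightarrow> 'o \<Rightarrow> 'm" where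
  "to_terminal X A = (THE t. t \<in> hom X A (Terminal X) \<and> total X t)"

definition is_pairing ::
  "('o, 'm, 'x) distributive_structure_scheme \<Rightarrow> 'o \<Rightarrow> 'o \<Rightarrow> 'm \<Rightarrow> 'm \<Rightarrow> 'm \<Rightarrow> bool" where
  "is_pairing X A B f g h \<longleftrightarrow>
     h \<in> hom X (Dom X f) (A \<otimes>\<^bsub>X\<^esub> B) \<and>
     h \<cdot>\<^bsub>X\<^esub> Proj0 X A B = \<rho>\<^bsub>X\<^esub> g \<cdot>\<^bsub>X\<^esub> f \<and>
     h \<cdot>\<^bsub>X\<^esub> Proj1 X A B = \<rho>\<^bsub>X\<^esub> f \<cdot>\<^bsub>X\<^esub> g"

definition pairing :: "('o, 'm, 'x) distributive_structure_scheme \<Rightarrow> 'm \<Rightarrow> 'm \<Rightarrow> 'm" where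
  "pairing X f g = (THE h. is_pairing X (Cod X f) (Cod X g) f g h)"

locale cartesian_restriction_category =
  restriction_category X for X :: "('o, 'm, 'x) distributive_structure_scheme" (structure) +
  assumes Terminal_Ob: "Terminal X \<in> Ob X"
    and to_terminal_unique: "A \<in> Ob X \<Longrightarrow> \<exists>!t. t \<in> hom X A (Terminal X) \<and> total X t"
    and to_terminal_natural:
      "f \<in> hom X A B \<Longrightarrow> f \<cdot> to_terminal X B = \<rho> f \<cdot> to_terminal X A"
    and ProdOb_Ob: "A \<in> Ob X \<Longrightarrow> B \<in> Ob X \<Longrightarrow> A \<otimes> B \<in> Ob X"
    and Proj0_hom: "A \<in> Ob X \<Longrightarrow> B \<in> Ob X \<Longrightarrow> Proj0 X A B \<in> hom X (A \<otimes> B) A"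
    and Proj1_hom: "A \<in> Ob X \<Longrightarrow> B \<in> Ob X \<Longrightarrow> Proj1 X A B \<in> hom X (A \<otimes> B) B"
    and Proj0_total: "A \<in> Ob X \<Longrightarrow> B \<in> Ob X \<Longrightarrow> total X (Proj0 X A B)"
    and Proj1_total: "A \<in> Ob X \<Longrightarrow> B \<in> Ob X \<Longrightarrow> total X (Proj1 X A B)"
    and pairing_unique:
      "f \<in> hom X C A \<Longrightarrow> g \<in> hom X C B \<Longrightarrow> \<exists>!h. is_pairing X A B f g h"

definition from_initial :: "('o, 'm, 'x) distributive_structure_scheme \<Rightarrow> 'o \<Rightarrow> 'm" where
  "from_initial X A = (THE z. z \<in> hom X (Initial X) A)"

definition is_copairing ::
  "('o, 'm, 'x) distributive_structure_scheme \<Rightarrow> 'o \<Rightarrow> 'o \<Rightarrow> 'm \<Rightarrow> 'm \<Rightarrow> 'm \<Rightarrow> bool" where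
  "is_copairing X A B f g h \<longleftrightarrow>
     h \<in> hom X (A \<oplus>\<^bsub>X\<^esub> B) (Cod X f) \<and>
     Inj0 X A B \<cdot>\<^bsub>X\<^esub> h = f \<and>
     Inj1 X A B \<cdot>\<^bsub>X\<^esub> h = g"

definition copairing :: "('o, 'm, 'x) distributive_structure_scheme \<Rightarrow> 'm \<Rightarrow> 'm \<Rightarrow> 'm" where
  "copairing X f g = (THE h. is_copairing X (Dom X f) (Dom X g) f g h)"

locale cocartesian_restriction_category =
  restriction_category X for X :: "('o, 'm, 'x) distributive_structure_scheme" (structure) +
  assumes Initial_Ob: "Initial X \<in> Ob X"
    and from_initial_unique: "A \<in> Ob X \<Longrightarrow> \<exists>!z. z \<in> hom X (Initial X) A"
    and SumOb_Ob: "A \<in> Ob X \<Longrightarrow> B \<in> Ob X \<Longrightarrow> A \<oplus> B \<in> Ob X"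
    and Inj0_hom: "A \<in> Ob X \<Longrightarrow> B \<in> Ob X \<Longrightarrow> Inj0 X A B \<in> hom X A (A \<oplus> B)"
    and Inj1_hom: "A \<in> Ob X \<Longrightarrow> B \<in> Ob X \<Longrightarrow> Inj1 X A B \<in> hom X B (A \<oplus> B)"
    and Inj0_total: "A \<in> Ob X \<Longrightarrow> B \<in> Ob X \<Longrightarrow> total X (Inj0 X A B)"
    and Inj1_total: "A \<in> Ob X \<Longrightarrow> B \<in> Ob X \<Longrightarrow> total X (Inj1 X A B)"
    and copairing_unique:
      "f \<in> hom X A C \<Longrightarrow> g \<in> hom X B C \<Longrightarrow> \<exists>!h. is_copairing X A B f g h"

text \<open>The map \<open>1\<^sub>A \<times> h\<close> for \<open>h : B \<rightarrow> C\<close>.\<close>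

definition id_times :: "('o, 'm, 'x) distributive_structure_scheme \<Rightarrow> 'o \<Rightarrow> 'm \<Rightarrow> 'm" where
  "id_times X A h = pairing X (Proj0 X A (Dom X h)) (Proj1 X A (Dom X h) \<cdot>\<^bsub>X\<^esub> h)"

locale distributive_restriction_category =
  cartesian_restriction_category X + cocartesian_restriction_category X
  for X :: "('o, 'm, 'x) distributive_structure_scheme" (structure) +
  assumes distributive_Sum:
      "A \<in> Ob X \<Longrightarrow> B \<in> Ob X \<Longrightarrow> C \<in> Ob X \<Longrightarrow>
        iso_arr X ((A \<otimes> B) \<oplus> (A \<otimes> C)) (A \<otimes> (B \<oplus> C))
          (copairing X (id_times X A (Inj0 X B C)) (id_times X A (Inj1 X B C)))"
    and distributive_Initial:
      "A \<in> Ob X \<Longrightarrow>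
        iso_arr X (Initial X) (A \<otimes> Initial X)
          (pairing X (from_initial X A) (\<one> (Initial X)))"


subsection \<open>Classical products\<close>

text \<open>
  The ternary coproduct is the iterated binary one, bracketed to the left, and
  correspondingly \<open>[f, g, h] = [[f, g], h]\<close>.
\<close>

definition copairing3 :: "('o, 'm, 'x) distributive_structure_scheme \<Rightarrow> 'm \<Rightarrow> 'm \<Rightarrow> 'm \<Rightarrow> 'm" where
  "copairing3 X f g h = copairing X (copairing X f g) h"

definition classical_prod :: "('o, 'm, 'x) distributive_structure_scheme \<Rightarrow> 'o \<Rightarrow> 'o \<Rightarrow> 'o" where
  "classical_prod X A B = A \<oplus>\<^bsub>X\<^esub> B \<oplus>\<^bsub>X\<^esub> (A \<otimes>\<^bsub>X\<^esub> B)"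

definition classical_proj0 :: "('o, 'm, 'x) distributive_structure_scheme \<Rightarrow> 'o \<Rightarrow> 'o \<Rightarrow> 'm" where
  "classical_proj0 X A B = copairing3 X (\<one>\<^bsub>X\<^esub> A) (zero_arr X B A) (Proj0 X A B)"

definition classical_proj1 :: "('o, 'm, 'x) distributive_structure_scheme \<Rightarrow> 'o \<Rightarrow> 'o \<Rightarrow> 'm" where
  "classical_proj1 X A B = copairing3 X (zero_arr X A B) (\<one>\<^bsub>X\<^esub> B) (Proj1 X A B)"

definition has_classical_products :: "('o, 'm, 'x) distributive_structure_scheme \<Rightarrow> bool" where
  "has_classical_products X \<longleftrightarrow>
     has_restriction_zeroes X \<and>
     (\<forall>A \<in> Ob X. \<forall>B \<in> Ob X.
        is_product X A B (classical_prod X A B) (classical_proj0 X A B) (classical_proj1 X A B))"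

end

theory Submission
  imports Defs
begin

text \<open>
  A set \<open>F\<close> of maps out of \<open>A\<close> is said to cover a map \<open>j\<close> out of \<open>A\<close> if any two parallel maps that
  agree on the domain of every \<open>f \<in> F\<close> agree on the domain of \<open>j\<close>. Coverings are the common currency
  of both directions, because they arise from two sources.

  First, joins are coverings: an upper bound of \<open>F\<close> that is covered by \<open>F\<close> is the join of \<open>F\<close>
  (\<open>join_if_covers\<close>), and in a join restriction category every finite join is covered by its parts
  (\<open>join_covers\<close>). Secondly, coproducts give coverings: in the presence of restriction zeroes,
  distributivity makes coproducts extensive, so a map \<open>f : A \<rightarrow> B \<oplus> C\<close> is covered by its
  two components \<open>f[1, 0] : A \<rightarrow> B\<close> and \<open>f[0, 1] : A \<rightarrow> C\<close> (\<open>summands_cover\<close>). Consequently a map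
  \<open>h : C \<rightarrow> A \<oplus> B \<oplus> (A \<times> B)\<close> is covered by three pieces \<open>a\<close>, \<open>b\<close>, \<open>c\<close> with disjoint domains.
  If \<open>f = h p\<^sub>0\<close> and \<open>g = h p\<^sub>1\<close>, then \<open>a\<close> is \<open>f\<close> where \<open>g\<close> is undefined, \<open>b\<close> is \<open>g\<close> where \<open>f\<close> is
  undefined, and \<open>c\<close> is \<open>\<langle>f, g\<rangle>\<close>. Hence \<open>h\<close> is determined by \<open>f\<close> and \<open>g\<close>
  (\<open>classical_projections_jointly_monic\<close>).

  It remains to compare existence of such an \<open>h\<close> with the classical structure. Given classical
  products and compatible \<open>f, g : A \<rightarrow> B\<close>, the pairing \<open>h : A \<rightarrow> B & B\<close> of \<open>f\<close> and \<open>g\<close> followed by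
  \<open>[1, 1, \<pi>\<^sub>0]\<close> agrees with \<open>f\<close> or \<open>g\<close> on every piece, so it is their join, and it is visibly stable
  under precomposition. For \<open>f \<le> g\<close>, the piece \<open>a\<close> of the pairing of \<open>g\<close> and \<open>f\<close> is the relative
  complement \<open>g \ f\<close>. Conversely, in a classical restriction category the pieces \<open>a\<close>, \<open>b\<close> exist as
  the relative complements of the restrictions of \<open>f\<close> and \<open>g\<close> to their common domain, and the
  required \<open>h\<close> is the join of the three disjoint maps \<open>a \<iota>\<^sub>0\<close>, \<open>b \<iota>\<^sub>1\<close>, \<open>\<langle>f, g\<rangle> \<iota>\<^sub>2\<close>.
\<close>

section \<open>Calculating in categories and restriction categories\<close>

context category
begin

text \<open>
  Typing is phrased through \<open>Dom\<close> and \<open>Cod\<close>, because then the side conditions of every rewrite rule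
  mention only variables that occur in its left-hand side.
\<close>

lemma hom_iff [simp]: "f \<in> hom X A B \<longleftrightarrow> f \<in> Arr X \<and> Dom X f = A \<and> Cod X f = B"
  by (simp add: hom_def)

declare Dom_Ob [simp] Cod_Ob [simp]

lemma Ident_typing [simp]:
  assumes "A \<in> Ob X"
  shows "\<one> A \<in> Arr X" "Dom X (\<one> A) = A" "Cod X (\<one> A) = A"
  using Ident_hom[OF assms] by simp_all

lemma Comp_typing [simp]:
  assumes "f \<in> Arr X" "g \<in> Arr X" "Cod X f = Dom X g"
  shows "f \<cdot> g \<in> Arr X" "Dom X (f \<cdot> g) = Dom X f" "Cod X (f \<cdot> g) = Cod X g"
  using Comp_hom[of f "Dom X f" "Dom X g" g "Cod X g"] assms by simp_all

lemma Ident_comp [simp]: "f \<in> Arr X \<Longrightarrow> Dom X f = A \<Longrightarrow> \<one> A \<cdot> f = f"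
  using Ident_left[of f A "Cod X f"] by simp

lemma comp_Ident [simp]: "f \<in> Arr X \<Longrightarrow> Cod X f = B \<Longrightarrow> f \<cdot> \<one> B = f"
  using Ident_right[of f "Dom X f" B] by simp

lemma comp_assoc [simp]:
  "f \<in> Arr X \<Longrightarrow> g \<in> Arr X \<Longrightarrow> h \<in> Arr X \<Longrightarrow> Cod X f = Dom X g \<Longrightarrow> Cod X g = Dom X h
    \<Longrightarrow> (f \<cdot> g) \<cdot> h = f \<cdot> (g \<cdot> h)"
  using Comp_assoc[of f "Dom X f" "Cod X f" g "Cod X g" h "Cod X h"] by simp

text \<open>
  Composites are kept bracketed to the right, so an equation \<open>f \<cdot> g = k\<close> must also be available
  with a further factor behind it.
\<close>

lemma comp_eq_extend:
  assumes "f \<cdot> g = k" "f \<in> Arr X" "g \<in> Arr X" "Cod X f = Dom X g" "h \<in> Arr X" "Dom X h = Cod X g"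
  shows "f \<cdot> (g \<cdot> h) = k \<cdot> h"
  using assms by (metis comp_assoc)

end

context restriction_category
begin

lemma Restr_typing [simp]:
  assumes "f \<in> Arr X"
  shows "\<rho> f \<in> Arr X" "Dom X (\<rho> f) = Dom X f" "Cod X (\<rho> f) = Dom X f"
  using Restr_hom[of f "Dom X f" "Cod X f"] assms by simp_all

lemma Restr_comp [simp]: "f \<in> Arr X \<Longrightarrow> \<rho> f \<cdot> f = f"
  using R1[of f "Dom X f" "Cod X f"] by simp

lemma Restr_comp_left [simp]:
  "f \<in> Arr X \<Longrightarrow> k \<in> Arr X \<Longrightarrow> Cod X f = Dom X k \<Longrightarrow> \<rho> f \<cdot> (f \<cdot> k) = f \<cdot> k"
  by (rule comp_eq_extend) simp_all

lemma Restr_commute: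
  "f \<in> Arr X \<Longrightarrow> g \<in> Arr X \<Longrightarrow> Dom X f = Dom X g \<Longrightarrow> \<rho> f \<cdot> \<rho> g = \<rho> g \<cdot> \<rho> f"
  using R2[of f "Dom X f" "Cod X f" g "Cod X g"] by simp

lemma Restr_left_commute:
  assumes "f \<in> Arr X" "g \<in> Arr X" "k \<in> Arr X" "Dom X f = Dom X k" "Dom X g = Dom X k"
  shows "\<rho> f \<cdot> (\<rho> g \<cdot> k) = \<rho> g \<cdot> (\<rho> f \<cdot> k)"
proof -
  have "\<rho> f \<cdot> (\<rho> g \<cdot> k) = (\<rho> f \<cdot> \<rho> g) \<cdot> k" using assms by simp
  also have "\<dots> = (\<rho> g \<cdot> \<rho> f) \<cdot> k" using assms Restr_commute by simp
  also have "\<dots> = \<rho> g \<cdot> (\<rho> f \<cdot> k)" using assms by simp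
  finally show ?thesis .
qed

lemma Restr_Restr_comp [simp]:
  "f \<in> Arr X \<Longrightarrow> g \<in> Arr X \<Longrightarrow> Dom X f = Dom X g \<Longrightarrow> \<rho> (\<rho> g \<cdot> f) = \<rho> g \<cdot> \<rho> f"
  using R3[of f "Dom X f" "Cod X f" g "Cod X g"] by simp

lemma Restr_idem [simp]: "f \<in> Arr X \<Longrightarrow> \<rho> f \<cdot> \<rho> f = \<rho> f"
  using Restr_Restr_comp[of f f] by (simp del: Restr_Restr_comp)

lemma Restr_idem_left [simp]:
  "f \<in> Arr X \<Longrightarrow> k \<in> Arr X \<Longrightarrow> Dom X f = Dom X k \<Longrightarrow> \<rho> f \<cdot> (\<rho> f \<cdot> k) = \<rho> f \<cdot> k"
  by (rule comp_eq_extend) simp_all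

lemma Restr_Ident [simp]: "A \<in> Ob X \<Longrightarrow> \<rho> (\<one> A) = \<one> A"
  using Restr_comp[of "\<one> A"] by (simp del: Restr_comp)

lemma Restr_Restr [simp]: "f \<in> Arr X \<Longrightarrow> \<rho> (\<rho> f) = \<rho> f"
  using Restr_Restr_comp[of "\<one> (Dom X f)" f] by (simp del: Restr_Restr_comp)

lemma comp_Restr:
  "f \<in> Arr X \<Longrightarrow> g \<in> Arr X \<Longrightarrow> Cod X f = Dom X g \<Longrightarrow> f \<cdot> \<rho> g = \<rho> (f \<cdot> g) \<cdot> f"
  using R4[of f "Dom X f" "Dom X g" g "Cod X g"] by simp

text \<open>
  The fourth axiom pulls a restriction back along a map: \<open>f\<close> followed by a restriction to the domain
  of \<open>g\<close> is \<open>f\<close> restricted to the domain of \<open>f \<cdot> g\<close>. Nearly all computations below that move a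
  restriction through a projection, an injection or a copairing are instances.
\<close>

lemma comp_Restr_left:
  assumes "f \<in> Arr X" "g \<in> Arr X" "k \<in> Arr X" "Cod X f = Dom X g" "Dom X k = Dom X g"
  shows "f \<cdot> (\<rho> g \<cdot> k) = \<rho> (f \<cdot> g) \<cdot> (f \<cdot> k)"
  using comp_eq_extend[OF comp_Restr[of f g], of k] assms by simp

lemma Restr_comp_le [simp]:
  assumes "f \<in> Arr X" "g \<in> Arr X" "Cod X f = Dom X g"
  shows "\<rho> f \<cdot> \<rho> (f \<cdot> g) = \<rho> (f \<cdot> g)"
  using Restr_Restr_comp[of "f \<cdot> g" f] assms by (simp del: Restr_Restr_comp)

lemma Restr_comp_ge [simp]:
  assumes "f \<in> Arr X" "g \<in> Arr X" "Cod X f = Dom X g"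
  shows "\<rho> (f \<cdot> g) \<cdot> \<rho> f = \<rho> (f \<cdot> g)"
  using Restr_comp_le[OF assms] Restr_commute[of f "f \<cdot> g"] assms by simp

text \<open>
  The domain of a composite depends on the second factor only through its domain.
\<close>

lemma Restr_comp_Restr [simp]:
  assumes "f \<in> Arr X" "g \<in> Arr X" "Cod X f = Dom X g"
  shows "\<rho> (f \<cdot> \<rho> g) = \<rho> (f \<cdot> g)"
  using assms by (simp add: comp_Restr[of f g])

lemma Restr_comp_total:
  assumes "f \<in> Arr X" "g \<in> Arr X" "Cod X f = Dom X g" "total X g"
  shows "\<rho> (f \<cdot> g) = \<rho> f"
  using Restr_comp_Restr[OF assms(1-3)] assms by (simp add: total_def del: Restr_comp_Restr)

section \<open>The order on parallel maps and its joins\<close>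

lemma restr_le_Restr:
  assumes "restr_le X f g" "f \<in> Arr X" "g \<in> Arr X" "Dom X f = Dom X g"
  shows "\<rho> f \<cdot> \<rho> g = \<rho> f"
  using Restr_Restr_comp[of g f] assms by (simp add: restr_le_def del: Restr_Restr_comp)

lemma restr_le_antisym:
  assumes "f \<in> hom X A B" "g \<in> hom X A B" "restr_le X f g" "restr_le X g f"
  shows "f = g"
proof -
  have "\<rho> f = \<rho> g"
    using restr_le_Restr[of f g] restr_le_Restr[of g f] Restr_commute[of f g] assms by simp
  then have "f = \<rho> g \<cdot> g" using assms(3) by (metis restr_le_def)
  then show ?thesis using assms(2) by simp
qed

lemma restr_le_trans:
  assumes "f \<in> hom X A B" "g \<in> hom X A B" "h \<in> hom X A B" "restr_le X f g" "restr_le X g h"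
  shows "restr_le X f h"
proof -
  have "\<rho> f \<cdot> h = (\<rho> f \<cdot> \<rho> g) \<cdot> h" using restr_le_Restr[of f g] assms by simp
  also have "\<dots> = \<rho> f \<cdot> (\<rho> g \<cdot> h)" using assms by simp
  finally show ?thesis using assms by (simp add: restr_le_def)
qed

lemma Restr_of_restricted:
  "\<rho> f \<cdot> g = k \<Longrightarrow> f \<in> Arr X \<Longrightarrow> g \<in> Arr X \<Longrightarrow> Dom X f = Dom X g \<Longrightarrow> \<rho> f \<cdot> \<rho> g = \<rho> k"
  using Restr_Restr_comp by metis

lemma restr_le_restrict:
  assumes "f \<in> Arr X" "g \<in> Arr X" "Dom X f = Dom X g"
  shows "restr_le X (\<rho> f \<cdot> g) g"
  using assms by (simp add: restr_le_def)

lemma join_typing: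
  assumes "is_join X A B F j"
  shows "j \<in> Arr X" "Dom X j = A" "Cod X j = B"
  using assms by (simp_all add: is_join_def)

lemma join_upper: "is_join X A B F j \<Longrightarrow> f \<in> F \<Longrightarrow> restr_le X f j"
  by (simp add: is_join_def)

lemma join_least:
  "is_join X A B F j \<Longrightarrow> k \<in> hom X A B \<Longrightarrow> (\<And>f. f \<in> F \<Longrightarrow> restr_le X f k) \<Longrightarrow> restr_le X j k"
  unfolding is_join_def by blast

lemma join_unique: "is_join X A B F j \<Longrightarrow> is_join X A B F k \<Longrightarrow> j = k"
  using restr_le_antisym unfolding is_join_def by blast

text \<open>
  Finite joins are built from binary ones, because \<open>f\<close> together with the join of \<open>F\<close> has the same
  upper bounds as \<open>insert f F\<close>.
\<close>

lemma join_insert: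
  assumes F: "insert f F \<subseteq> hom X A B" and j: "is_join X A B F j" and s: "is_join X A B {f, j} s"
  shows "is_join X A B (insert f F) s"
proof -
  have jA: "j \<in> hom X A B" and sA: "s \<in> hom X A B"
    using join_typing[OF j] join_typing[OF s] by simp_all
  have "restr_le X g s" if "g \<in> insert f F" for g
  proof (cases "g = f")
    case False
    then have g: "g \<in> F" using that by simp
    show ?thesis
      by (rule restr_le_trans[OF _ jA sA join_upper[OF j g] join_upper[OF s]]) (use g F in auto)
  qed (use join_upper[OF s] in simp)
  moreover have "restr_le X s k" if k: "k \<in> hom X A B" "\<forall>g \<in> insert f F. restr_le X g k" for k
    using join_least[OF s k(1)] join_least[OF j k(1)] k(2) by blast
  ultimately show ?thesis using sA unfolding is_join_def by blast
qed

lemma compatible_precomp: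
  assumes "f \<in> hom X A B" "g \<in> hom X A B" "compatible X f g" "x \<in> hom X C A"
  shows "compatible X (x \<cdot> f) (x \<cdot> g)"
  using comp_Restr_left[of x f g] comp_Restr_left[of x g f] assms by (simp add: compatible_def)

lemma compatible_if_bounded:
  assumes "f \<in> hom X A B" "g \<in> hom X A B" "k \<in> hom X A B" "restr_le X f k" "restr_le X g k"
  shows "compatible X f g"
  using assms Restr_left_commute[of f g k] by (simp add: restr_le_def compatible_def)

end

section \<open>Coverings\<close>

text \<open>
  Only the domains of the maps in \<open>F\<close> matter, so their codomains may differ; this allows the three
  components of a map into a ternary coproduct to form a cover.
\<close>

definition covers :: "('o, 'm, 'x) restriction_structure_scheme \<Rightarrow> 'm set \<Rightarrow> 'm \<Rightarrow> bool" where
  "covers X F j \<longleftrightarrow>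
     (\<forall>B. \<forall>u \<in> hom X (Dom X j) B. \<forall>v \<in> hom X (Dom X j) B.
        (\<forall>f \<in> F. \<rho>\<^bsub>X\<^esub> f \<cdot>\<^bsub>X\<^esub> u = \<rho>\<^bsub>X\<^esub> f \<cdot>\<^bsub>X\<^esub> v) \<longrightarrow> \<rho>\<^bsub>X\<^esub> j \<cdot>\<^bsub>X\<^esub> u = \<rho>\<^bsub>X\<^esub> j \<cdot>\<^bsub>X\<^esub> v)"

context restriction_category
begin

lemma coversI:
  assumes "\<And>B u v. u \<in> hom X (Dom X j) B \<Longrightarrow> v \<in> hom X (Dom X j) B
      \<Longrightarrow> (\<And>f. f \<in> F \<Longrightarrow> \<rho> f \<cdot> u = \<rho> f \<cdot> v) \<Longrightarrow> \<rho> j \<cdot> u = \<rho> j \<cdot> v"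
  shows "covers X F j"
  unfolding covers_def using assms by blast

lemma coversD:
  assumes "covers X F j" "u \<in> hom X (Dom X j) B" "v \<in> hom X (Dom X j) B"
    "\<And>f. f \<in> F \<Longrightarrow> \<rho> f \<cdot> u = \<rho> f \<cdot> v"
  shows "\<rho> j \<cdot> u = \<rho> j \<cdot> v"
  using assms unfolding covers_def by blast

text \<open>
  If \<open>k\<close> is a second upper bound, then \<open>j\<close> and \<open>k\<close> both restrict to \<open>f\<close> on the domain of each
  \<open>f \<in> F\<close>, so the cover forces them to agree on the domain of \<open>j\<close>.
\<close>

lemma join_if_covers:
  assumes j: "j \<in> hom X A B" and F: "F \<subseteq> hom X A B" and ub: "\<And>f. f \<in> F \<Longrightarrow> restr_le X f j"
    and cov: "covers X F j"
  shows "is_join X A B F j"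
  unfolding is_join_def
proof (intro conjI ballI impI)
  fix k assume k: "k \<in> hom X A B" and kub: "\<forall>f \<in> F. restr_le X f k"
  have "\<rho> j \<cdot> k = \<rho> j \<cdot> j"
  proof (rule coversD[OF cov])
    fix f assume "f \<in> F"
    then show "\<rho> f \<cdot> k = \<rho> f \<cdot> j"
      using ub kub by (simp add: restr_le_def)
  qed (use j k in simp_all)
  then show "restr_le X j k" using j by (simp add: restr_le_def)
qed (use j ub in auto)

end

section \<open>Joins in a join restriction category\<close>

context join_restriction_category
begin

text \<open>
  The idempotents \<open>\<rho> f\<close> are bounded by \<open>\<rho> j\<close> and so have a join \<open>e \<le> \<rho> j\<close>. Since \<open>e \<cdot> j\<close> is still
  above every \<open>f \<in> F\<close>, it is above \<open>j\<close>, whence \<open>\<rho> j \<le> e\<close>.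
\<close>

lemma join_Restr:
  assumes "A \<in> Ob X" "B \<in> Ob X" and F: "F \<subseteq> hom X A B" "finite F"
    and comp: "\<And>f g. f \<in> F \<Longrightarrow> g \<in> F \<Longrightarrow> compatible X f g"
    and j: "is_join X A B F j"
  shows "is_join X A A ((\<lambda>f. \<rho> f) ` F) (\<rho> j)"
proof -
  have jA: "j \<in> Arr X" "Dom X j = A" "Cod X j = B" using join_typing[OF j] by simp_all
  have FA: "f \<in> Arr X" "Dom X f = A" "Cod X f = B" "\<rho> f \<cdot> j = f" "\<rho> f \<cdot> \<rho> j = \<rho> f"
    if "f \<in> F" for f
    using that F jA join_upper[OF j, of f] restr_le_Restr[of f j] by (auto simp: restr_le_def)
  have RF: "(\<lambda>f. \<rho> f) ` F \<subseteq> hom X A A" "finite ((\<lambda>f. \<rho> f) ` F)" using FA F by auto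
  have "compatible X x y" if "x \<in> (\<lambda>f. \<rho> f) ` F" "y \<in> (\<lambda>f. \<rho> f) ` F" for x y
    using that FA Restr_commute by (auto simp: compatible_def)
  then obtain e where e: "is_join X A A ((\<lambda>f. \<rho> f) ` F) e"
    using join_exists[OF assms(1) assms(1) RF] by blast
  have eA: "e \<in> Arr X" "Dom X e = A" "Cod X e = A" using join_typing[OF e] by simp_all
  have e_le: "restr_le X e (\<rho> j)"
    by (rule join_least[OF e]) (use jA FA in \<open>auto simp: restr_le_def\<close>)
  have "restr_le X e (\<one> A)"
    by (rule join_least[OF e]) (use assms(1) FA in \<open>auto simp: restr_le_def\<close>)
  then have e_idem: "\<rho> e = e" using eA assms(1) by (simp add: restr_le_def)
  have fe: "\<rho> f \<cdot> e = \<rho> f" if "f \<in> F" for f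
    using join_upper[OF e, of "\<rho> f"] that FA by (simp add: restr_le_def)
  have "restr_le X f (e \<cdot> j)" if "f \<in> F" for f
  proof -
    have "\<rho> f \<cdot> (e \<cdot> j) = \<rho> f \<cdot> j" using that fe FA eA jA comp_eq_extend[of "\<rho> f" e "\<rho> f" j] by simp
    then show ?thesis using FA that by (simp add: restr_le_def)
  qed
  then have "restr_le X j (e \<cdot> j)" using join_least[OF j, of "e \<cdot> j"] eA jA by simp
  then have "\<rho> j \<cdot> \<rho> (e \<cdot> j) = \<rho> j" using restr_le_Restr eA jA by simp
  moreover have "\<rho> (e \<cdot> j) = \<rho> (\<rho> e \<cdot> j)" using e_idem by simp
  ultimately have "\<rho> j \<cdot> (\<rho> e \<cdot> \<rho> j) = \<rho> j" using eA jA by simp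
  then have "\<rho> e \<cdot> \<rho> j = \<rho> j" using eA jA Restr_left_commute[of j e "\<rho> j"] by simp
  moreover have "\<rho> e \<cdot> \<rho> j = e" using e_le by (simp add: restr_le_def)
  ultimately show ?thesis using e by simp
qed

text \<open>
  Suppose \<open>u\<close> and \<open>v\<close> agree on the domain of each \<open>f \<in> F\<close>. The common restrictions \<open>\<rho> f \<cdot> u = \<rho> f \<cdot> v\<close>
  lie below both \<open>u\<close> and \<open>v\<close>, hence so does their join \<open>k\<close>. Taking restrictions and using stability
  under precomposition with \<open>\<rho> u\<close> shows that the domain of \<open>k\<close> is \<open>\<rho> u \<cdot> \<rho> j\<close>. So \<open>u\<close> and \<open>v\<close> agree on
  \<open>\<rho> u \<cdot> \<rho> j\<close>, and by symmetry on \<open>\<rho> v \<cdot> \<rho> j\<close>; it follows that these two idempotents coincide.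
\<close>

lemma join_covers:
  assumes A: "A \<in> Ob X" "B \<in> Ob X" and F: "F \<subseteq> hom X A B" "finite F"
    and comp: "\<And>f g. f \<in> F \<Longrightarrow> g \<in> F \<Longrightarrow> compatible X f g"
    and j: "is_join X A B F j"
  shows "covers X F j"
proof (rule coversI)
  have jA: "j \<in> Arr X" "Dom X j = A" "Cod X j = B" using join_typing[OF j] by simp_all
  have FA: "f \<in> Arr X" "Dom X f = A" "Cod X f = B" "\<rho> f \<cdot> j = f" "\<rho> f \<cdot> \<rho> j = \<rho> f"
    if "f \<in> F" for f
    using that F jA join_upper[OF j, of f] restr_le_Restr[of f j] by (auto simp: restr_le_def)
  have half: "\<rho> j \<cdot> u = \<rho> u \<cdot> (\<rho> j \<cdot> v)"
    if u: "u \<in> hom X A D" and v: "v \<in> hom X A D" and eq: "\<And>f. f \<in> F \<Longrightarrow> \<rho> f \<cdot> u = \<rho> f \<cdot> v"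
    for u v D
  proof -
    have D: "D \<in> Ob X" using u Cod_Ob[of u] by simp
    let ?G = "(\<lambda>f. \<rho> f \<cdot> u) ` F"
    have G: "?G \<subseteq> hom X A D" "finite ?G" using F FA u by auto
    have Gu: "restr_le X g u" if "g \<in> ?G" for g
      using that FA u restr_le_restrict by auto
    have Gv: "restr_le X g v" if "g \<in> ?G" for g
      using that FA v eq restr_le_restrict by auto
    have Gc: "compatible X x y" if "x \<in> ?G" "y \<in> ?G" for x y
      using compatible_if_bounded[of x A D y u] that Gu G u by blast
    obtain k where k: "is_join X A D ?G k" using join_exists[OF A(1) D G Gc] by blast
    have kA: "k \<in> Arr X" "Dom X k = A" "Cod X k = D" using join_typing[OF k] by simp_all
    have ku: "\<rho> k \<cdot> u = k" and kv: "\<rho> k \<cdot> v = k"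
      using join_least[OF k u Gu] join_least[OF k v Gv] by (simp_all add: restr_le_def)
    \<comment> \<open>The domain of \<open>k\<close> is computed as a join in two ways.\<close>
    have "is_join X A A ((\<lambda>f. \<rho> f) ` ?G) (\<rho> k)" using join_Restr[OF A(1) D G Gc k] .
    moreover have "is_join X A A ((\<lambda>f. \<rho> u \<cdot> f) ` (\<lambda>f. \<rho> f) ` F) (\<rho> u \<cdot> \<rho> j)"
    proof (rule join_precomp[OF A(1) A(1) _ _ _ join_Restr[OF A F comp j]])
      show "compatible X x y" if "x \<in> (\<lambda>f. \<rho> f) ` F" "y \<in> (\<lambda>f. \<rho> f) ` F" for x y
        using that FA Restr_commute by (auto simp: compatible_def)
    qed (use F FA u in auto)
    moreover have "(\<lambda>f. \<rho> u \<cdot> f) ` (\<lambda>f. \<rho> f) ` F = (\<lambda>f. \<rho> f) ` ?G"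
      unfolding image_image using FA u Restr_commute by (intro image_cong) auto
    ultimately have "\<rho> k = \<rho> u \<cdot> \<rho> j" using join_unique by metis
    with ku kv have "(\<rho> u \<cdot> \<rho> j) \<cdot> u = (\<rho> u \<cdot> \<rho> j) \<cdot> v" by simp
    then show ?thesis using u v jA Restr_left_commute[of u j u] by simp
  qed
  fix D u v
  assume u: "u \<in> hom X (Dom X j) D" and v: "v \<in> hom X (Dom X j) D"
    and eq: "\<And>f. f \<in> F \<Longrightarrow> \<rho> f \<cdot> u = \<rho> f \<cdot> v"
  \<comment> \<open>Each side is a restriction of the other one, so they are equal.\<close>
  have 1: "\<rho> j \<cdot> u = \<rho> u \<cdot> (\<rho> j \<cdot> v)" and 2: "\<rho> j \<cdot> v = \<rho> v \<cdot> (\<rho> j \<cdot> u)"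
    using half[of u D v] half[of v D u] u v eq jA by simp_all
  have "\<rho> j \<cdot> u = \<rho> v \<cdot> (\<rho> u \<cdot> (\<rho> j \<cdot> v))"
    using u v jA 1 Restr_left_commute[of v u "\<rho> j \<cdot> v"] Restr_left_commute[of v j v] by simp
  also have "\<dots> = \<rho> j \<cdot> v" by (simp only: 1[symmetric] 2[symmetric])
  finally show "\<rho> j \<cdot> u = \<rho> j \<cdot> v" .
qed

text \<open>
  Stability of the empty join under precomposition is absorption on the left, and with minimality
  below \<open>1\<close> it shows that \<open>\<rho> 0 = 0\<close>. Absorption on the right then follows from minimality: \<open>0\<close> lies
  below \<open>0 \<cdot> f\<close>, so it is the restriction of \<open>0 \<cdot> f\<close> to the domain of \<open>0\<close>, which is \<open>0 \<cdot> f\<close> itself.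
\<close>

lemma empty_joins_are_zeroes: "has_restriction_zeroes X"
proof -
  define Z where "Z A B = (SOME z. is_join X A B {} z)" for A B
  have Zj: "is_join X A B {} (Z A B)" if "A \<in> Ob X" "B \<in> Ob X" for A B
    unfolding Z_def by (rule someI_ex, rule join_exists) (use that in auto)
  have Z: "Z A B \<in> Arr X" "Dom X (Z A B) = A" "Cod X (Z A B) = B" if "A \<in> Ob X" "B \<in> Ob X" for A B
    using join_typing[OF Zj[OF that]] by simp_all
  have least: "restr_le X (Z A B) k" if "A \<in> Ob X" "B \<in> Ob X" "k \<in> hom X A B" for A B k
    using join_least[OF Zj[OF that(1,2)] that(3)] by simp
  have right: "f \<cdot> Z B C = Z A C" if f: "f \<in> hom X A B" and C: "C \<in> Ob X" for f A B C
  proof -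
    have A: "A \<in> Ob X" and B: "B \<in> Ob X" using f Dom_Ob[of f] Cod_Ob[of f] by simp_all
    have "is_join X A C ((\<lambda>g. f \<cdot> g) ` {}) (f \<cdot> Z B C)"
      by (rule join_precomp[OF B C _ _ _ Zj[OF B C] f]) simp_all
    then show ?thesis using Zj[OF A C] join_unique by simp
  qed
  have idem: "\<rho> (Z A A) = Z A A" if "A \<in> Ob X" for A
    using least[of A A "\<one> A"] that Z by (simp add: restr_le_def)
  have Restr_Z: "\<rho> (Z A B) = Z A A" if A: "A \<in> Ob X" and B: "B \<in> Ob X" for A B
  proof -
    have "\<rho> (Z A B) = \<rho> (\<rho> (Z A A) \<cdot> Z A B)" using idem right[of "Z A A" A A B] A B Z by simp
    also have "\<dots> = \<rho> (Z A B) \<cdot> \<rho> (Z A A)" using A B Z Restr_commute by simp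
    also have "\<dots> = Z A A" using idem right[of "\<rho> (Z A B)" A A A] A B Z by simp
    finally show ?thesis .
  qed
  have left: "Z A B \<cdot> f = Z A C" if f: "f \<in> hom X B C" and A: "A \<in> Ob X" for f A B C
  proof -
    have B: "B \<in> Ob X" and C: "C \<in> Ob X" using f Dom_Ob[of f] Cod_Ob[of f] by simp_all
    have "Z A C = \<rho> (Z A C) \<cdot> (Z A B \<cdot> f)"
      using least[of A C "Z A B \<cdot> f"] f A B C Z by (simp add: restr_le_def)
    also have "\<dots> = \<rho> (Z A B) \<cdot> (Z A B \<cdot> f)" using Restr_Z A B C by simp
    also have "\<dots> = Z A B \<cdot> f" using f A B Z by simp
    finally show ?thesis by simp
  qed
  have "restriction_zeroes X Z"
    unfolding restriction_zeroes_def using Z right left Restr_Z by auto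
  then show ?thesis unfolding has_restriction_zeroes_def by blast
qed

end

section \<open>Zero maps\<close>

locale restriction_category_with_zeroes = restriction_category +
  assumes has_zeroes: "has_restriction_zeroes X"
begin

text \<open>
  Two families of zero maps agree because the composite of a member of each absorbs both ways.
\<close>

lemma zero_arr_zeroes: "restriction_zeroes X (zero_arr X)"
proof -
  obtain Z where Z: "restriction_zeroes X Z" using has_zeroes unfolding has_restriction_zeroes_def by blast
  have unique: "Z' A B = Z A B" if Z': "restriction_zeroes X Z'" and A: "A \<in> Ob X" "B \<in> Ob X" for Z' A B
  proof -
    have "Z A A \<cdot> Z' A B = Z A B" using Z Z' A unfolding restriction_zeroes_def by blast
    moreover have "Z A A \<cdot> Z' A B = Z' A B" using Z Z' A unfolding restriction_zeroes_def by blast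
    ultimately show ?thesis by simp
  qed
  have "zero_arr X A B = Z A B" if "A \<in> Ob X" "B \<in> Ob X" for A B
    unfolding zero_arr_def by (rule the_equality) (use Z that unique in blast)+
  then have "restriction_zeroes X (zero_arr X) \<longleftrightarrow> restriction_zeroes X Z"
    unfolding restriction_zeroes_def by (simp cong: ball_cong del: hom_iff)
  with Z show ?thesis by simp
qed

lemma zero_typing [simp]:
  assumes "A \<in> Ob X" "B \<in> Ob X"
  shows "zero_arr X A B \<in> Arr X" "Dom X (zero_arr X A B) = A" "Cod X (zero_arr X A B) = B"
  using zero_arr_zeroes assms unfolding restriction_zeroes_def by simp_all

text \<open>
  Domains are disjoint as soon as some \<open>e\<close> separates them.
\<close>

lemma Restr_disjoint:
  assumes "x \<in> Arr X" "y \<in> Arr X" "e \<in> Arr X" "Dom X x = C" "Dom X y = C" "Dom X e = C"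
    and "\<rho> x \<cdot> \<rho> e = \<rho> x" "\<rho> y \<cdot> \<rho> e = zero_arr X C C"
  shows "\<rho> x \<cdot> \<rho> y = zero_arr X C C"
proof -
  have C: "C \<in> Ob X" using assms Dom_Ob by blast
  have "\<rho> x \<cdot> \<rho> y = (\<rho> x \<cdot> \<rho> e) \<cdot> \<rho> y" using assms(7) by simp
  also have "\<dots> = \<rho> x \<cdot> (\<rho> y \<cdot> \<rho> e)" using assms(1-6) Restr_commute[of e y] by simp
  also have "\<dots> = zero_arr X C C"
    unfolding assms(8) using assms(1-6) C zero_arr_zeroes by (simp add: restriction_zeroes_def)
  finally show ?thesis .
qed

lemma zero_comp [simp]:
  assumes "A \<in> Ob X" "f \<in> Arr X" "Dom X f = B"
  shows "zero_arr X A B \<cdot> f = zero_arr X A (Cod X f)"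
  using zero_arr_zeroes assms Dom_Ob[of f] Cod_Ob[of f] unfolding restriction_zeroes_def by simp

lemma comp_zero [simp]:
  assumes "C \<in> Ob X" "f \<in> Arr X" "Cod X f = B"
  shows "f \<cdot> zero_arr X B C = zero_arr X (Dom X f) C"
  using zero_arr_zeroes assms Dom_Ob[of f] Cod_Ob[of f] unfolding restriction_zeroes_def by simp

lemma Restr_zero [simp]:
  assumes "A \<in> Ob X" "B \<in> Ob X"
  shows "\<rho> (zero_arr X A B) = zero_arr X A A"
  using zero_arr_zeroes assms unfolding restriction_zeroes_def by simp

end


section \<open>Products and coproducts\<close>

context cartesian_restriction_category
begin

declare ProdOb_Ob [simp]

lemma Proj_typing [simp]:
  assumes "A \<in> Ob X" "B \<in> Ob X"
  shows "Proj0 X A B \<in> Arr X" "Dom X (Proj0 X A B) = A \<otimes> B" "Cod X (Proj0 X A B) = A"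
    "Proj1 X A B \<in> Arr X" "Dom X (Proj1 X A B) = A \<otimes> B" "Cod X (Proj1 X A B) = B"
  using Proj0_hom[OF assms] Proj1_hom[OF assms] by simp_all

lemma Restr_Proj [simp]:
  assumes "A \<in> Ob X" "B \<in> Ob X"
  shows "\<rho> (Proj0 X A B) = \<one> (A \<otimes> B)" "\<rho> (Proj1 X A B) = \<one> (A \<otimes> B)"
  using Proj0_total[OF assms] Proj1_total[OF assms] assms by (simp_all add: total_def)

lemma Restr_comp_Proj [simp]:
  assumes "f \<in> Arr X" "Cod X f = A \<otimes> B" "A \<in> Ob X" "B \<in> Ob X"
  shows "\<rho> (f \<cdot> Proj0 X A B) = \<rho> f" "\<rho> (f \<cdot> Proj1 X A B) = \<rho> f"
  using assms Proj0_total Proj1_total by (simp_all add: Restr_comp_total)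

lemma is_pairing_pairing:
  assumes "f \<in> Arr X" "g \<in> Arr X" "Dom X f = Dom X g"
  shows "is_pairing X (Cod X f) (Cod X g) f g (pairing X f g)"
  unfolding pairing_def by (rule theI', rule pairing_unique[of f "Dom X f"]) (use assms in simp_all)

lemma pairing_typing [simp]:
  assumes "f \<in> Arr X" "g \<in> Arr X" "Dom X f = Dom X g"
  shows "pairing X f g \<in> Arr X" "Dom X (pairing X f g) = Dom X f"
    "Cod X (pairing X f g) = Cod X f \<otimes> Cod X g"
  using is_pairing_pairing[OF assms] assms by (simp_all add: is_pairing_def)

lemma pairing_Proj [simp]:
  assumes "f \<in> Arr X" "g \<in> Arr X" "Dom X f = Dom X g" "Cod X f = A" "Cod X g = B"
  shows "pairing X f g \<cdot> Proj0 X A B = \<rho> g \<cdot> f" "pairing X f g \<cdot> Proj1 X A B = \<rho> f \<cdot> g"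
  using is_pairing_pairing[OF assms(1-3)] assms by (simp_all add: is_pairing_def)

lemma pairing_Proj_left [simp]:
  assumes "f \<in> Arr X" "g \<in> Arr X" "Dom X f = Dom X g" "Cod X f = A" "Cod X g = B" "k \<in> Arr X"
  shows "Dom X k = A \<Longrightarrow> pairing X f g \<cdot> (Proj0 X A B \<cdot> k) = \<rho> g \<cdot> (f \<cdot> k)"
    and "Dom X k = B \<Longrightarrow> pairing X f g \<cdot> (Proj1 X A B \<cdot> k) = \<rho> f \<cdot> (g \<cdot> k)"
proof -
  have O: "A \<in> Ob X" "B \<in> Ob X" using assms Cod_Ob by blast+
  show "Dom X k = A \<Longrightarrow> pairing X f g \<cdot> (Proj0 X A B \<cdot> k) = \<rho> g \<cdot> (f \<cdot> k)"
    using comp_eq_extend[OF pairing_Proj(1)[OF assms(1-5)], of k] assms O by simp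
  show "Dom X k = B \<Longrightarrow> pairing X f g \<cdot> (Proj1 X A B \<cdot> k) = \<rho> f \<cdot> (g \<cdot> k)"
    using comp_eq_extend[OF pairing_Proj(2)[OF assms(1-5)], of k] assms O by simp
qed

text \<open>
  The projections are total, so the two composites \<open>u \<cdot> \<pi>\<^sub>i\<close> have the same domain and the
  cross-restrictions in the universal property of the restriction product are vacuous.
\<close>

lemma Proj_jointly_monic:
  assumes "A \<in> Ob X" "B \<in> Ob X" "u \<in> hom X C (A \<otimes> B)" "v \<in> hom X C (A \<otimes> B)"
    and "u \<cdot> Proj0 X A B = v \<cdot> Proj0 X A B" "u \<cdot> Proj1 X A B = v \<cdot> Proj1 X A B"
  shows "u = v"
proof -
  have id: "\<rho> (w \<cdot> Proj1 X A B) \<cdot> (w \<cdot> Proj0 X A B) = w \<cdot> Proj0 X A B"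
    "\<rho> (w \<cdot> Proj0 X A B) \<cdot> (w \<cdot> Proj1 X A B) = w \<cdot> Proj1 X A B" if "w \<in> hom X C (A \<otimes> B)" for w
    using that assms(1,2) by simp_all
  have "is_pairing X A B (u \<cdot> Proj0 X A B) (u \<cdot> Proj1 X A B) u"
    using id[OF assms(3)] assms(1-3) unfolding is_pairing_def by simp
  moreover have "is_pairing X A B (u \<cdot> Proj0 X A B) (u \<cdot> Proj1 X A B) v"
    using id[OF assms(4)] assms unfolding is_pairing_def by simp
  ultimately show ?thesis
    using pairing_unique[of "u \<cdot> Proj0 X A B" C A "u \<cdot> Proj1 X A B" B] assms(1-3) by auto
qed

lemma id_times_typing [simp]:
  assumes "A \<in> Ob X" "h \<in> Arr X"
  shows "id_times X A h \<in> Arr X" "Dom X (id_times X A h) = A \<otimes> Dom X h"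
    "Cod X (id_times X A h) = A \<otimes> Cod X h"
  using assms by (simp_all add: id_times_def)

lemma id_times_Proj:
  assumes "A \<in> Ob X" "h \<in> Arr X" "total X h"
  shows "id_times X A h \<cdot> Proj0 X A (Cod X h) = Proj0 X A (Dom X h)"
    "id_times X A h \<cdot> Proj1 X A (Cod X h) = Proj1 X A (Dom X h) \<cdot> h"
  using assms by (simp_all add: id_times_def Restr_comp_total)

end

context cocartesian_restriction_category
begin

declare SumOb_Ob [simp]

lemma Inj_typing [simp]:
  assumes "A \<in> Ob X" "B \<in> Ob X"
  shows "Inj0 X A B \<in> Arr X" "Dom X (Inj0 X A B) = A" "Cod X (Inj0 X A B) = A \<oplus> B"
    "Inj1 X A B \<in> Arr X" "Dom X (Inj1 X A B) = B" "Cod X (Inj1 X A B) = A \<oplus> B"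
  using Inj0_hom[OF assms] Inj1_hom[OF assms] by simp_all

lemma Restr_Inj [simp]:
  assumes "A \<in> Ob X" "B \<in> Ob X"
  shows "\<rho> (Inj0 X A B) = \<one> A" "\<rho> (Inj1 X A B) = \<one> B"
  using Inj0_total[OF assms] Inj1_total[OF assms] assms by (simp_all add: total_def)

lemma Restr_comp_Inj [simp]:
  assumes "f \<in> Arr X" "A \<in> Ob X" "B \<in> Ob X"
  shows "Cod X f = A \<Longrightarrow> \<rho> (f \<cdot> Inj0 X A B) = \<rho> f" "Cod X f = B \<Longrightarrow> \<rho> (f \<cdot> Inj1 X A B) = \<rho> f"
  using assms Inj0_total Inj1_total by (simp_all add: Restr_comp_total)

lemma is_copairing_copairing:
  assumes "f \<in> Arr X" "g \<in> Arr X" "Cod X f = Cod X g"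
  shows "is_copairing X (Dom X f) (Dom X g) f g (copairing X f g)"
  unfolding copairing_def
  by (rule theI', rule copairing_unique[where C = "Cod X f"]) (use assms in simp_all)

lemma copairing_typing [simp]:
  assumes "f \<in> Arr X" "g \<in> Arr X" "Cod X f = Cod X g"
  shows "copairing X f g \<in> Arr X" "Dom X (copairing X f g) = Dom X f \<oplus> Dom X g"
    "Cod X (copairing X f g) = Cod X f"
  using is_copairing_copairing[OF assms] assms by (simp_all add: is_copairing_def)

lemma Inj_copairing [simp]:
  assumes "f \<in> Arr X" "g \<in> Arr X" "Cod X f = Cod X g" "Dom X f = A" "Dom X g = B"
  shows "Inj0 X A B \<cdot> copairing X f g = f" "Inj1 X A B \<cdot> copairing X f g = g"
  using is_copairing_copairing[OF assms(1-3)] assms by (simp_all add: is_copairing_def)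

lemma Inj_copairing_left [simp]:
  assumes "f \<in> Arr X" "g \<in> Arr X" "Cod X f = Cod X g" "Dom X f = A" "Dom X g = B"
    and "k \<in> Arr X" "Dom X k = Cod X f"
  shows "Inj0 X A B \<cdot> (copairing X f g \<cdot> k) = f \<cdot> k" "Inj1 X A B \<cdot> (copairing X f g \<cdot> k) = g \<cdot> k"
proof -
  have O: "A \<in> Ob X" "B \<in> Ob X" using assms Dom_Ob by blast+
  show "Inj0 X A B \<cdot> (copairing X f g \<cdot> k) = f \<cdot> k"
    by (rule comp_eq_extend) (use assms O in simp_all)
  show "Inj1 X A B \<cdot> (copairing X f g \<cdot> k) = g \<cdot> k"
    by (rule comp_eq_extend) (use assms O in simp_all)
qed

lemma Inj_jointly_epic:
  assumes "A \<in> Ob X" "B \<in> Ob X" "u \<in> hom X (A \<oplus> B) C" "v \<in> hom X (A \<oplus> B) C"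
    and "Inj0 X A B \<cdot> u = Inj0 X A B \<cdot> v" "Inj1 X A B \<cdot> u = Inj1 X A B \<cdot> v"
  shows "u = v"
proof -
  have "is_copairing X A B (Inj0 X A B \<cdot> u) (Inj1 X A B \<cdot> u) u"
    using assms(1-3) unfolding is_copairing_def by simp
  moreover have "is_copairing X A B (Inj0 X A B \<cdot> u) (Inj1 X A B \<cdot> u) v"
    using assms unfolding is_copairing_def by simp
  ultimately show ?thesis
    using copairing_unique[of "Inj0 X A B \<cdot> u" A C "Inj1 X A B \<cdot> u" B] assms(1-3) by auto
qed

lemma copairing_comp:
  assumes "f \<in> Arr X" "g \<in> Arr X" "k \<in> Arr X" "Cod X f = Cod X g" "Dom X k = Cod X f"
  shows "copairing X f g \<cdot> k = copairing X (f \<cdot> k) (g \<cdot> k)"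
  by (rule Inj_jointly_epic[of "Dom X f" "Dom X g"]) (use assms in simp_all)

end

section \<open>Distributivity makes coproducts extensive\<close>

context distributive_restriction_category
begin

lemma distributor:
  assumes A: "A \<in> Ob X" and B: "B \<in> Ob X" and C: "C \<in> Ob X"
  obtains d s where
    "d \<in> hom X ((A \<otimes> B) \<oplus> (A \<otimes> C)) (A \<otimes> (B \<oplus> C))"
    "s \<in> hom X (A \<otimes> (B \<oplus> C)) ((A \<otimes> B) \<oplus> (A \<otimes> C))"
    "d \<cdot> s = \<one> ((A \<otimes> B) \<oplus> (A \<otimes> C))" "s \<cdot> d = \<one> (A \<otimes> (B \<oplus> C))"
    "Inj0 X (A \<otimes> B) (A \<otimes> C) \<cdot> d = id_times X A (Inj0 X B C)"
    "Inj1 X (A \<otimes> B) (A \<otimes> C) \<cdot> d = id_times X A (Inj1 X B C)"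
proof -
  let ?d = "copairing X (id_times X A (Inj0 X B C)) (id_times X A (Inj1 X B C))"
  obtain s where s: "s \<in> hom X (A \<otimes> (B \<oplus> C)) ((A \<otimes> B) \<oplus> (A \<otimes> C))"
    "?d \<cdot> s = \<one> ((A \<otimes> B) \<oplus> (A \<otimes> C))" "s \<cdot> ?d = \<one> (A \<otimes> (B \<oplus> C))"
    using distributive_Sum[OF A B C] unfolding iso_arr_def by blast
  have "?d \<in> hom X ((A \<otimes> B) \<oplus> (A \<otimes> C)) (A \<otimes> (B \<oplus> C))" using A B C by simp
  then show thesis using that[OF _ s] A B C by simp
qed

lemma id_times_Inj_Proj:
  assumes "A \<in> Ob X" "B \<in> Ob X" "C \<in> Ob X"
  shows "id_times X A (Inj0 X B C) \<cdot> Proj0 X A (B \<oplus> C) = Proj0 X A B"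
    "id_times X A (Inj0 X B C) \<cdot> Proj1 X A (B \<oplus> C) = Proj1 X A B \<cdot> Inj0 X B C"
    "id_times X A (Inj1 X B C) \<cdot> Proj0 X A (B \<oplus> C) = Proj0 X A C"
    "id_times X A (Inj1 X B C) \<cdot> Proj1 X A (B \<oplus> C) = Proj1 X A C \<cdot> Inj1 X B C"
  using id_times_Proj[of A "Inj0 X B C"] id_times_Proj[of A "Inj1 X B C"] assms
    Inj0_total Inj1_total by simp_all

text \<open>
  The map \<open>k\<close> sends \<open>a\<close> to \<open>(a, f a)\<close>, moved into the summand selected by \<open>f a\<close>. Its definition is the
  graph of \<open>f\<close> followed by the inverse of the distributor; it tags every argument by the side on
  which \<open>f\<close> takes its value. The last equation expresses that a tagged argument can be evaluated
  again: if \<open>a\<close> is tagged with \<open>B\<close>, then \<open>f a\<close> really lies in \<open>B\<close>. This is what fails for an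
  arbitrary map into \<open>(A \<otimes> B) \<oplus> (A \<otimes> C)\<close>. It comes from naturality of the distributor along \<open>f \<times> 1\<close>
  and from the diagonal of \<open>Y = B \<oplus> C\<close>, which factors through the distributor of \<open>Y\<close> by
  \<open>\<langle>\<iota>\<^sub>0, 1\<rangle>\<close> on \<open>B\<close> and by \<open>\<langle>\<iota>\<^sub>1, 1\<rangle>\<close> on \<open>C\<close>.
\<close>

lemma decision:
  assumes Y: "B \<in> Ob X" "C \<in> Ob X" and f: "f \<in> hom X A (B \<oplus> C)"
  obtains k where "k \<in> hom X A ((A \<otimes> B) \<oplus> (A \<otimes> C))" "\<rho> f \<cdot> k = k"
    "k \<cdot> copairing X (Proj0 X A B) (Proj0 X A C) = \<rho> f"
    "\<forall>D. \<forall>r \<in> hom X (B \<oplus> C) D. \<forall>t \<in> hom X (B \<oplus> C) D.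
      k \<cdot> copairing X (Proj0 X A B \<cdot> (f \<cdot> r)) (Proj0 X A C \<cdot> (f \<cdot> t))
        = f \<cdot> copairing X (Inj0 X B C \<cdot> r) (Inj1 X B C \<cdot> t)"
proof -
  have A [simp]: "A \<in> Ob X" using f Dom_Ob[of f] by simp
  note Y [simp]
  define Y where "Y = B \<oplus> C"
  have Y_fold [simp]: "B \<oplus> C = Y" by (simp add: Y_def)
  have Y' [simp]: "Y \<in> Ob X" using SumOb_Ob[OF Y] by simp
  have f' [simp]: "f \<in> Arr X" "Dom X f = A" "Cod X f = Y" using f by simp_all
  have Inj [simp]: "Inj0 X B C \<in> Arr X" "Dom X (Inj0 X B C) = B" "Cod X (Inj0 X B C) = Y"
    "Inj1 X B C \<in> Arr X" "Dom X (Inj1 X B C) = C" "Cod X (Inj1 X B C) = Y"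
    using Inj_typing[OF Y] by simp_all
  let ?A2 = "(A \<otimes> B) \<oplus> (A \<otimes> C)" and ?Y2 = "(Y \<otimes> B) \<oplus> (Y \<otimes> C)"
  let ?j0 = "Inj0 X (Y \<otimes> B) (Y \<otimes> C)" and ?j1 = "Inj1 X (Y \<otimes> B) (Y \<otimes> C)"
  obtain d s where d: "d \<in> hom X ?A2 (A \<otimes> (B \<oplus> C))" "s \<in> hom X (A \<otimes> (B \<oplus> C)) ?A2"
    "d \<cdot> s = \<one> ?A2" "s \<cdot> d = \<one> (A \<otimes> (B \<oplus> C))"
    "Inj0 X (A \<otimes> B) (A \<otimes> C) \<cdot> d = id_times X A (Inj0 X B C)"
    "Inj1 X (A \<otimes> B) (A \<otimes> C) \<cdot> d = id_times X A (Inj1 X B C)"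
    by (rule distributor[OF A Y])
  obtain d' s' where d': "d' \<in> hom X ?Y2 (Y \<otimes> (B \<oplus> C))" "s' \<in> hom X (Y \<otimes> (B \<oplus> C)) ?Y2"
    "d' \<cdot> s' = \<one> ?Y2" "s' \<cdot> d' = \<one> (Y \<otimes> (B \<oplus> C))"
    "?j0 \<cdot> d' = id_times X Y (Inj0 X B C)"
    "?j1 \<cdot> d' = id_times X Y (Inj1 X B C)"
    by (rule distributor[OF Y' Y])
  have dA [simp]: "d \<in> Arr X" "Dom X d = ?A2" "Cod X d = A \<otimes> Y"
    "s \<in> Arr X" "Dom X s = A \<otimes> Y" "Cod X s = ?A2"
    "d' \<in> Arr X" "Dom X d' = ?Y2" "Cod X d' = Y \<otimes> Y"
    "s' \<in> Arr X" "Dom X s' = Y \<otimes> Y" "Cod X s' = ?Y2"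
    using d(1,2) d'(1,2) by simp_all
  have inj_d [simp]: "Inj0 X (A \<otimes> B) (A \<otimes> C) \<cdot> (d \<cdot> g) = id_times X A (Inj0 X B C) \<cdot> g"
    "Inj1 X (A \<otimes> B) (A \<otimes> C) \<cdot> (d \<cdot> g) = id_times X A (Inj1 X B C) \<cdot> g"
    if "g \<in> Arr X" "Dom X g = A \<otimes> Y" for g
    using comp_eq_extend[OF d(5), of g] comp_eq_extend[OF d(6), of g] that by simp_all
  have E [simp]: "id_times X Z (Inj0 X B C) \<cdot> Proj0 X Z Y = Proj0 X Z B"
    "id_times X Z (Inj0 X B C) \<cdot> Proj1 X Z Y = Proj1 X Z B \<cdot> Inj0 X B C"
    "id_times X Z (Inj1 X B C) \<cdot> Proj0 X Z Y = Proj0 X Z C"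
    "id_times X Z (Inj1 X B C) \<cdot> Proj1 X Z Y = Proj1 X Z C \<cdot> Inj1 X B C" if "Z \<in> Ob X" for Z
    using id_times_Inj_Proj[OF that Y] by simp_all
  have E_left [simp]: "id_times X A (Inj0 X B C) \<cdot> (Proj0 X A Y \<cdot> g) = Proj0 X A B \<cdot> g"
    "id_times X A (Inj1 X B C) \<cdot> (Proj0 X A Y \<cdot> g) = Proj0 X A C \<cdot> g"
    if "g \<in> Arr X" "Dom X g = A" for g
    using comp_eq_extend[OF E(1), of A g] comp_eq_extend[OF E(3), of A g] that by simp_all
  let ?e = "pairing X (\<one> A) f"
  \<comment> \<open>The maps \<open>f \<times> 1\<close> on \<open>A \<otimes> B\<close>, \<open>A \<otimes> C\<close> and \<open>A \<otimes> Y\<close>; \<open>m\<close> is the sum of the first two, and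
    \<open>n\<close> is the diagonal of \<open>Y\<close> written as a map into \<open>(Y \<otimes> B) \<oplus> (Y \<otimes> C)\<close>.\<close>
  define F0 where "F0 = pairing X (Proj0 X A B \<cdot> f) (Proj1 X A B)"
  define F1 where "F1 = pairing X (Proj0 X A C \<cdot> f) (Proj1 X A C)"
  define F where "F = pairing X (Proj0 X A Y \<cdot> f) (Proj1 X A Y)"
  have FA [simp]: "F0 \<in> Arr X" "Dom X F0 = A \<otimes> B" "Cod X F0 = Y \<otimes> B"
     "F1 \<in> Arr X" "Dom X F1 = A \<otimes> C" "Cod X F1 = Y \<otimes> C"
     "F \<in> Arr X" "Dom X F = A \<otimes> Y" "Cod X F = Y \<otimes> Y"
    by (simp_all add: F0_def F1_def F_def)
  define m where "m = copairing X (F0 \<cdot> ?j0) (F1 \<cdot> ?j1)"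
  define n where
    "n = copairing X (pairing X (Inj0 X B C) (\<one> B) \<cdot> ?j0) (pairing X (Inj1 X B C) (\<one> C) \<cdot> ?j1)"
  have mn [simp]: "m \<in> Arr X" "Dom X m = ?A2" "Cod X m = ?Y2"
    "n \<in> Arr X" "Dom X n = Y" "Cod X n = ?Y2"
    by (simp_all add: m_def n_def)
  have i0: "F0 \<cdot> id_times X Y (Inj0 X B C) = id_times X A (Inj0 X B C) \<cdot> F"
    by (rule Proj_jointly_monic[of Y Y _ "A \<otimes> B"])
      (simp_all add: F0_def F_def
        comp_Restr_left[of "id_times X A (Inj0 X B C)" "Proj0 X A Y \<cdot> f" "Proj1 X A Y"])
  have i1: "F1 \<cdot> id_times X Y (Inj1 X B C) = id_times X A (Inj1 X B C) \<cdot> F"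
    by (rule Proj_jointly_monic[of Y Y _ "A \<otimes> C"])
      (simp_all add: F1_def F_def
        comp_Restr_left[of "id_times X A (Inj1 X B C)" "Proj0 X A Y \<cdot> f" "Proj1 X A Y"])
  have natural: "m \<cdot> d' = d \<cdot> F"
    by (rule Inj_jointly_epic[of "A \<otimes> B" "A \<otimes> C" _ "Y \<otimes> Y"])
      (simp_all add: m_def d' i0 i1)
  have diagonal: "pairing X (\<one> Y) (\<one> Y) = n \<cdot> d'"
  proof (rule Inj_jointly_epic[OF Y])
    show "Inj0 X B C \<cdot> pairing X (\<one> Y) (\<one> Y) = Inj0 X B C \<cdot> (n \<cdot> d')"
      by (rule Proj_jointly_monic[of Y Y _ B]) (simp_all add: n_def d')
    show "Inj1 X B C \<cdot> pairing X (\<one> Y) (\<one> Y) = Inj1 X B C \<cdot> (n \<cdot> d')"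
      by (rule Proj_jointly_monic[of Y Y _ C]) (simp_all add: n_def d')
  qed simp_all
  \<comment> \<open>On elements both sides send \<open>a\<close> to \<open>(f a, f a)\<close>.\<close>
  have graph: "?e \<cdot> F = f \<cdot> pairing X (\<one> Y) (\<one> Y)"
    by (rule Proj_jointly_monic[of Y Y _ A])
      (simp_all add: F_def comp_Restr_left[of ?e "Proj0 X A Y \<cdot> f" "Proj1 X A Y"])
  have sm: "s \<cdot> m = F \<cdot> s'"
  proof -
    have "s \<cdot> m = s \<cdot> (m \<cdot> (d' \<cdot> s'))" using d'(3) by simp
    also have "\<dots> = s \<cdot> ((m \<cdot> d') \<cdot> s')" by simp
    also have "\<dots> = (s \<cdot> d) \<cdot> (F \<cdot> s')" unfolding natural by simp
    also have "\<dots> = F \<cdot> s'" using d(4) by simp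
    finally show ?thesis .
  qed
  have em: "?e \<cdot> (s \<cdot> m) = f \<cdot> n"
  proof -
    have "?e \<cdot> (s \<cdot> m) = (?e \<cdot> F) \<cdot> s'" unfolding sm by simp
    also have "\<dots> = f \<cdot> (n \<cdot> (d' \<cdot> s'))" unfolding graph diagonal by simp
    also have "\<dots> = f \<cdot> n" using d'(3) by simp
    finally show ?thesis .
  qed
  show thesis
  proof (rule that[of "?e \<cdot> s"])
    have "\<rho> f \<cdot> ?e = ?e"
      by (rule Proj_jointly_monic[of A Y _ A]) simp_all
    then show "\<rho> f \<cdot> (?e \<cdot> s) = ?e \<cdot> s"
      using comp_eq_extend[of "\<rho> f" ?e ?e s] by simp
    have "copairing X (Proj0 X A B) (Proj0 X A C) = d \<cdot> Proj0 X A Y"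
      by (rule Inj_jointly_epic[of "A \<otimes> B" "A \<otimes> C" _ A]) simp_all
    then have "(?e \<cdot> s) \<cdot> copairing X (Proj0 X A B) (Proj0 X A C) = ?e \<cdot> ((s \<cdot> d) \<cdot> Proj0 X A Y)"
      by simp
    also have "\<dots> = \<rho> f" using d(4) by simp
    finally show "(?e \<cdot> s) \<cdot> copairing X (Proj0 X A B) (Proj0 X A C) = \<rho> f" .
    show "\<forall>D. \<forall>r \<in> hom X (B \<oplus> C) D. \<forall>t \<in> hom X (B \<oplus> C) D.
      (?e \<cdot> s) \<cdot> copairing X (Proj0 X A B \<cdot> (f \<cdot> r)) (Proj0 X A C \<cdot> (f \<cdot> t))
        = f \<cdot> copairing X (Inj0 X B C \<cdot> r) (Inj1 X B C \<cdot> t)"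
    proof (intro allI ballI)
      fix D r t assume "r \<in> hom X (B \<oplus> C) D" "t \<in> hom X (B \<oplus> C) D"
      then have rt [simp]: "r \<in> Arr X" "Dom X r = Y" "Cod X r = D" "t \<in> Arr X" "Dom X t = Y" "Cod X t = D"
        by simp_all
      \<comment> \<open>Compose \<open>?e \<cdot> (s \<cdot> m) = f \<cdot> n\<close> with the map that drops the second factor and
        applies \<open>r\<close> or \<open>t\<close> to the first.\<close>
      let ?q = "copairing X (Proj0 X Y B \<cdot> r) (Proj0 X Y C \<cdot> t)"
      have mq: "m \<cdot> ?q = copairing X (Proj0 X A B \<cdot> (f \<cdot> r)) (Proj0 X A C \<cdot> (f \<cdot> t))"
        by (rule Inj_jointly_epic[of "A \<otimes> B" "A \<otimes> C" _ D]) (simp_all add: m_def F0_def F1_def)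
      have nq: "n \<cdot> ?q = copairing X (Inj0 X B C \<cdot> r) (Inj1 X B C \<cdot> t)"
        by (rule Inj_jointly_epic[OF Y, of _ D]) (simp_all add: n_def)
      show "(?e \<cdot> s) \<cdot> copairing X (Proj0 X A B \<cdot> (f \<cdot> r)) (Proj0 X A C \<cdot> (f \<cdot> t))
          = f \<cdot> copairing X (Inj0 X B C \<cdot> r) (Inj1 X B C \<cdot> t)"
        using comp_eq_extend[of ?e "s \<cdot> m" "f \<cdot> n" ?q] em unfolding mq[symmetric] nq[symmetric] by simp
    qed
  qed simp_all
qed

end


locale distributive_restriction_category_with_zeroes =
  distributive_restriction_category X + restriction_category_with_zeroes X
  for X :: "('o, 'm, 'x) distributive_structure_scheme" (structure)
begin

text \<open>
  Zero maps give each injection a partial inverse, defined exactly on its image.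
\<close>

abbreviation coproj0 :: "'o \<Rightarrow> 'o \<Rightarrow> 'm" where
  "coproj0 B C \<equiv> copairing X (\<one> B) (zero_arr X C B)"

abbreviation coproj1 :: "'o \<Rightarrow> 'o \<Rightarrow> 'm" where
  "coproj1 B C \<equiv> copairing X (zero_arr X B C) (\<one> C)"

lemma Restr_coproj:
  assumes "B \<in> Ob X" "C \<in> Ob X"
  shows "\<rho> (coproj0 B C) = coproj0 B C \<cdot> Inj0 X B C" "\<rho> (coproj1 B C) = coproj1 B C \<cdot> Inj1 X B C"
proof -
  show "\<rho> (coproj0 B C) = coproj0 B C \<cdot> Inj0 X B C"
    by (rule Inj_jointly_epic[of B C _ "B \<oplus> C"])
      (use assms in \<open>simp_all add: comp_Restr[of "Inj0 X B C" "coproj0 B C"]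
        comp_Restr[of "Inj1 X B C" "coproj0 B C"]\<close>)
  show "\<rho> (coproj1 B C) = coproj1 B C \<cdot> Inj1 X B C"
    by (rule Inj_jointly_epic[of B C _ "B \<oplus> C"])
      (use assms in \<open>simp_all add: comp_Restr[of "Inj0 X B C" "coproj1 B C"]
        comp_Restr[of "Inj1 X B C" "coproj1 B C"]\<close>)
qed

text \<open>
  On the domain of its component in \<open>B\<close>, the map \<open>f\<close> factors through the injection of \<open>B\<close>.
\<close>

lemma Restr_comp_coproj:
  assumes "B \<in> Ob X" "C \<in> Ob X" "f \<in> hom X A (B \<oplus> C)"
  shows "\<rho> (f \<cdot> coproj0 B C) \<cdot> f = (f \<cdot> coproj0 B C) \<cdot> Inj0 X B C"
    "\<rho> (f \<cdot> coproj1 B C) \<cdot> f = (f \<cdot> coproj1 B C) \<cdot> Inj1 X B C"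
  using comp_Restr[of f "coproj0 B C"] comp_Restr[of f "coproj1 B C"] Restr_coproj[OF assms(1,2)] assms
  by simp_all

text \<open>
  Let \<open>k\<close> be the tagging of \<open>f\<close>. A point tagged with \<open>B\<close> lies in the domain of \<open>f[1, 0]\<close>, and a point
  tagged with \<open>C\<close> in that of \<open>f[0, 1]\<close>; in equations, \<open>k\<close> absorbs the idempotent \<open>\<rho> w\<close> that restricts
  the two summands to these domains. As \<open>\<rho> f \<cdot> u\<close> is \<open>k\<close> followed by \<open>u\<close> on both summands, \<open>u\<close> is only
  evaluated on the domains of the two components.
\<close>

lemma summands_cover:
  assumes Y: "B \<in> Ob X" "C \<in> Ob X" and f: "f \<in> hom X A (B \<oplus> C)"
  shows "covers X {f \<cdot> coproj0 B C, f \<cdot> coproj1 B C} f"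
proof (rule coversI)
  fix D u v assume "u \<in> hom X (Dom X f) D" "v \<in> hom X (Dom X f) D"
  then have uv [simp]: "u \<in> Arr X" "Dom X u = A" "Cod X u = D" "v \<in> Arr X" "Dom X v = A" "Cod X v = D"
    using f by simp_all
  assume "\<And>g. g \<in> {f \<cdot> coproj0 B C, f \<cdot> coproj1 B C} \<Longrightarrow> \<rho> g \<cdot> u = \<rho> g \<cdot> v"
  then have eq: "\<rho> (f \<cdot> coproj0 B C) \<cdot> u = \<rho> (f \<cdot> coproj0 B C) \<cdot> v"
    "\<rho> (f \<cdot> coproj1 B C) \<cdot> u = \<rho> (f \<cdot> coproj1 B C) \<cdot> v" by simp_all
  have A [simp]: "A \<in> Ob X" "D \<in> Ob X" using f Dom_Ob[of f] Cod_Ob[of u] by simp_all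
  note Y [simp]
  have f' [simp]: "f \<in> Arr X" "Dom X f = A" "Cod X f = B \<oplus> C" using f by simp_all
  let ?i0 = "Inj0 X (A \<otimes> B) (A \<otimes> C)" and ?i1 = "Inj1 X (A \<otimes> B) (A \<otimes> C)"
  let ?p0 = "Proj0 X A B" and ?p1 = "Proj0 X A C"
  obtain k where k: "k \<in> hom X A ((A \<otimes> B) \<oplus> (A \<otimes> C))" "\<rho> f \<cdot> k = k"
    "k \<cdot> copairing X ?p0 ?p1 = \<rho> f"
    "\<forall>D. \<forall>r \<in> hom X (B \<oplus> C) D. \<forall>t \<in> hom X (B \<oplus> C) D.
      k \<cdot> copairing X (?p0 \<cdot> (f \<cdot> r)) (?p1 \<cdot> (f \<cdot> t))
        = f \<cdot> copairing X (Inj0 X B C \<cdot> r) (Inj1 X B C \<cdot> t)"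
    by (rule decision[OF Y f])
  have k' [simp]: "k \<in> Arr X" "Dom X k = A" "Cod X k = (A \<otimes> B) \<oplus> (A \<otimes> C)" using k(1) by simp_all
  define w where "w = copairing X (?p0 \<cdot> (f \<cdot> (coproj0 B C \<cdot> Inj0 X B C)))
    (?p1 \<cdot> (f \<cdot> (coproj1 B C \<cdot> Inj1 X B C)))"
  have w [simp]: "w \<in> Arr X" "Dom X w = (A \<otimes> B) \<oplus> (A \<otimes> C)" "Cod X w = B \<oplus> C"
    by (simp_all add: w_def)
  have "copairing X (Inj0 X B C) (Inj1 X B C) = \<one> (B \<oplus> C)"
    by (rule Inj_jointly_epic[OF Y, of _ "B \<oplus> C"]) simp_all
  then have kw: "k \<cdot> w = f"
    unfolding w_def using k(4)[rule_format, of "coproj0 B C \<cdot> Inj0 X B C" "B \<oplus> C" "coproj1 B C \<cdot> Inj1 X B C"]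
    by simp
  \<comment> \<open>Since \<open>k \<cdot> w = f\<close> and \<open>k\<close> is defined only where \<open>f\<close> is, \<open>k\<close> lands in the domain of \<open>w\<close>.\<close>
  have k_w: "k \<cdot> \<rho> w = k"
    using comp_Restr[of k w] kw k(2) by simp
  have w_eq: "\<rho> w \<cdot> copairing X (?p0 \<cdot> u) (?p1 \<cdot> u) = \<rho> w \<cdot> copairing X (?p0 \<cdot> v) (?p1 \<cdot> v)"
  proof (rule Inj_jointly_epic[of "A \<otimes> B" "A \<otimes> C" _ D])
    have "?i0 \<cdot> (\<rho> w \<cdot> copairing X (?p0 \<cdot> x) (?p1 \<cdot> x)) = ?p0 \<cdot> (\<rho> (f \<cdot> coproj0 B C) \<cdot> x)"
      if x: "x \<in> hom X A D" for x
    proof -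
      have "?i0 \<cdot> (\<rho> w \<cdot> copairing X (?p0 \<cdot> x) (?p1 \<cdot> x)) = \<rho> (?i0 \<cdot> w) \<cdot> (?p0 \<cdot> x)"
        using x comp_Restr_left[of ?i0 w "copairing X (?p0 \<cdot> x) (?p1 \<cdot> x)"] by simp
      also have "\<rho> (?i0 \<cdot> w) = \<rho> (((?p0 \<cdot> f) \<cdot> coproj0 B C) \<cdot> Inj0 X B C)"
        unfolding w_def by simp
      also have "\<dots> = \<rho> (?p0 \<cdot> (f \<cdot> coproj0 B C))"
        by (subst Restr_comp_Inj(1)) simp_all
      finally show ?thesis
        using x comp_Restr_left[of ?p0 "f \<cdot> coproj0 B C" x] by simp
    qed
    then show "?i0 \<cdot> (\<rho> w \<cdot> copairing X (?p0 \<cdot> u) (?p1 \<cdot> u)) = ?i0 \<cdot> (\<rho> w \<cdot> copairing X (?p0 \<cdot> v) (?p1 \<cdot> v))"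
      using eq(1) by simp
    have "?i1 \<cdot> (\<rho> w \<cdot> copairing X (?p0 \<cdot> x) (?p1 \<cdot> x)) = ?p1 \<cdot> (\<rho> (f \<cdot> coproj1 B C) \<cdot> x)"
      if x: "x \<in> hom X A D" for x
    proof -
      have "?i1 \<cdot> (\<rho> w \<cdot> copairing X (?p0 \<cdot> x) (?p1 \<cdot> x)) = \<rho> (?i1 \<cdot> w) \<cdot> (?p1 \<cdot> x)"
        using x comp_Restr_left[of ?i1 w "copairing X (?p0 \<cdot> x) (?p1 \<cdot> x)"] by simp
      also have "\<rho> (?i1 \<cdot> w) = \<rho> (((?p1 \<cdot> f) \<cdot> coproj1 B C) \<cdot> Inj1 X B C)"
        unfolding w_def by simp
      also have "\<dots> = \<rho> (?p1 \<cdot> (f \<cdot> coproj1 B C))"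
        by (subst Restr_comp_Inj(2)) simp_all
      finally show ?thesis
        using x comp_Restr_left[of ?p1 "f \<cdot> coproj1 B C" x] by simp
    qed
    then show "?i1 \<cdot> (\<rho> w \<cdot> copairing X (?p0 \<cdot> u) (?p1 \<cdot> u)) = ?i1 \<cdot> (\<rho> w \<cdot> copairing X (?p0 \<cdot> v) (?p1 \<cdot> v))"
      using eq(2) by simp
  qed simp_all
  have "\<rho> f \<cdot> x = k \<cdot> (\<rho> w \<cdot> copairing X (?p0 \<cdot> x) (?p1 \<cdot> x))" if x: "x \<in> hom X A D" for x
  proof -
    have "\<rho> f \<cdot> x = (k \<cdot> copairing X ?p0 ?p1) \<cdot> x" using k(3) by simp
    also have "\<dots> = k \<cdot> copairing X (?p0 \<cdot> x) (?p1 \<cdot> x)" using x by (simp add: copairing_comp)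
    also have "\<dots> = k \<cdot> (\<rho> w \<cdot> copairing X (?p0 \<cdot> x) (?p1 \<cdot> x))"
      using comp_eq_extend[OF k_w, of "copairing X (?p0 \<cdot> x) (?p1 \<cdot> x)"] x by simp
    finally show ?thesis .
  qed
  then show "\<rho> f \<cdot> u = \<rho> f \<cdot> v" using w_eq by simp
qed

section \<open>Maps into the object of a classical product\<close>

text \<open>
  The binary covering is applied twice, to the outer sum \<open>(A \<oplus> B) \<oplus> (A \<otimes> B)\<close> and to the component \<open>x\<close>
  of \<open>h\<close> in \<open>A \<oplus> B\<close>.
\<close>

lemma classical_components:
  assumes Y: "A \<in> Ob X" "B \<in> Ob X" and h: "h \<in> hom X C (classical_prod X A B)"
  obtains a b c where "a \<in> hom X C A" "b \<in> hom X C B" "c \<in> hom X C (A \<otimes> B)"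
    "\<rho> a \<cdot> h = a \<cdot> (Inj0 X A B \<cdot> Inj0 X (A \<oplus> B) (A \<otimes> B))"
    "\<rho> b \<cdot> h = b \<cdot> (Inj1 X A B \<cdot> Inj0 X (A \<oplus> B) (A \<otimes> B))"
    "\<rho> c \<cdot> h = c \<cdot> Inj1 X (A \<oplus> B) (A \<otimes> B)"
    "covers X {a, b, c} h"
proof -
  let ?S = "A \<oplus> B" and ?P = "A \<otimes> B"
  note Y [simp]
  have h': "h \<in> hom X C (?S \<oplus> ?P)" using h by (simp add: classical_prod_def)
  then have [simp]: "h \<in> Arr X" "Dom X h = C" "Cod X h = ?S \<oplus> ?P" by simp_all
  have C [simp]: "C \<in> Ob X" using Dom_Ob[of h] by simp
  define x where "x = h \<cdot> coproj0 ?S ?P"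
  define c where "c = h \<cdot> coproj1 ?S ?P"
  have x [simp]: "x \<in> Arr X" "Dom X x = C" "Cod X x = ?S" by (simp_all add: x_def)
  define a where "a = x \<cdot> coproj0 A B"
  define b where "b = x \<cdot> coproj1 A B"
  have abc [simp]: "a \<in> Arr X" "Dom X a = C" "Cod X a = A" "b \<in> Arr X" "Dom X b = C" "Cod X b = B"
    "c \<in> Arr X" "Dom X c = C" "Cod X c = ?P" by (simp_all add: a_def b_def c_def)
  have xh: "\<rho> x \<cdot> h = x \<cdot> Inj0 X ?S ?P" and ch: "\<rho> c \<cdot> h = c \<cdot> Inj1 X ?S ?P"
    unfolding x_def c_def using Restr_comp_coproj[of ?S ?P h C] by simp_all
  have ax: "\<rho> a \<cdot> x = a \<cdot> Inj0 X A B" and bx: "\<rho> b \<cdot> x = b \<cdot> Inj1 X A B"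
    unfolding a_def b_def using Restr_comp_coproj[of A B x C] by simp_all
  have le: "\<rho> a \<cdot> \<rho> x = \<rho> a" "\<rho> b \<cdot> \<rho> x = \<rho> b" unfolding a_def b_def by simp_all
  show thesis
  proof (rule that[of a b c])
    have "\<rho> a \<cdot> h = \<rho> a \<cdot> (\<rho> x \<cdot> h)" using comp_eq_extend[OF le(1), of h] by simp
    also have "\<dots> = (\<rho> a \<cdot> x) \<cdot> Inj0 X ?S ?P" unfolding xh by simp
    finally show "\<rho> a \<cdot> h = a \<cdot> (Inj0 X A B \<cdot> Inj0 X ?S ?P)" unfolding ax by simp
    have "\<rho> b \<cdot> h = \<rho> b \<cdot> (\<rho> x \<cdot> h)" using comp_eq_extend[OF le(2), of h] by simp
    also have "\<dots> = (\<rho> b \<cdot> x) \<cdot> Inj0 X ?S ?P" unfolding xh by simp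
    finally show "\<rho> b \<cdot> h = b \<cdot> (Inj1 X A B \<cdot> Inj0 X ?S ?P)" unfolding bx by simp
    show "covers X {a, b, c} h"
    proof (rule coversI)
      fix D u v assume uv: "u \<in> hom X (Dom X h) D" "v \<in> hom X (Dom X h) D"
        and eq: "\<And>g. g \<in> {a, b, c} \<Longrightarrow> \<rho> g \<cdot> u = \<rho> g \<cdot> v"
      have "\<rho> x \<cdot> u = \<rho> x \<cdot> v"
        by (rule coversD[OF summands_cover[OF Y, of x C]]) (use uv eq in \<open>auto simp: a_def b_def\<close>)
      moreover have "\<rho> c \<cdot> u = \<rho> c \<cdot> v" using eq by simp
      ultimately show "\<rho> h \<cdot> u = \<rho> h \<cdot> v"
        by (intro coversD[OF summands_cover[of ?S ?P h C]]) (use uv in \<open>auto simp: x_def c_def\<close>)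
    qed
  qed (simp_all add: ch)
qed

lemma classical_proj_typing [simp]:
  assumes "A \<in> Ob X" "B \<in> Ob X"
  shows "classical_prod X A B \<in> Ob X"
    "classical_proj0 X A B \<in> Arr X" "Dom X (classical_proj0 X A B) = classical_prod X A B"
    "Cod X (classical_proj0 X A B) = A"
    "classical_proj1 X A B \<in> Arr X" "Dom X (classical_proj1 X A B) = classical_prod X A B"
    "Cod X (classical_proj1 X A B) = B"
  using assms
  by (simp_all add: classical_prod_def classical_proj0_def classical_proj1_def copairing3_def)

text \<open>
  Each projection is read off piece by piece. In particular \<open>g\<close> is undefined on the domain of \<open>a\<close>,
  \<open>f\<close> is undefined on the domain of \<open>b\<close>, and both are defined on the domain of \<open>c\<close>.
\<close>

lemma classical_projections:
  assumes Y: "A \<in> Ob X" "B \<in> Ob X" and h: "h \<in> hom X C (classical_prod X A B)"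
    and f: "h \<cdot> classical_proj0 X A B = f" and g: "h \<cdot> classical_proj1 X A B = g"
  obtains a b c where "a \<in> hom X C A" "b \<in> hom X C B" "c \<in> hom X C (A \<otimes> B)"
    "\<rho> a \<cdot> h = a \<cdot> (Inj0 X A B \<cdot> Inj0 X (A \<oplus> B) (A \<otimes> B))"
    "\<rho> b \<cdot> h = b \<cdot> (Inj1 X A B \<cdot> Inj0 X (A \<oplus> B) (A \<otimes> B))"
    "\<rho> c \<cdot> h = c \<cdot> Inj1 X (A \<oplus> B) (A \<otimes> B)"
    "covers X {a, b, c} h"
    "\<rho> a \<cdot> f = a" "\<rho> a \<cdot> g = zero_arr X C B"
    "\<rho> b \<cdot> f = zero_arr X C A" "\<rho> b \<cdot> g = b"
    "\<rho> c \<cdot> f = c \<cdot> Proj0 X A B" "\<rho> c \<cdot> g = c \<cdot> Proj1 X A B"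
proof -
  obtain a b c where *: "a \<in> hom X C A" "b \<in> hom X C B" "c \<in> hom X C (A \<otimes> B)"
    "\<rho> a \<cdot> h = a \<cdot> (Inj0 X A B \<cdot> Inj0 X (A \<oplus> B) (A \<otimes> B))"
    "\<rho> b \<cdot> h = b \<cdot> (Inj1 X A B \<cdot> Inj0 X (A \<oplus> B) (A \<otimes> B))"
    "\<rho> c \<cdot> h = c \<cdot> Inj1 X (A \<oplus> B) (A \<otimes> B)"
    "covers X {a, b, c} h"
    by (rule classical_components[OF Y h])
  note Y [simp]
  have [simp]: "a \<in> Arr X" "Dom X a = C" "Cod X a = A" "b \<in> Arr X" "Dom X b = C" "Cod X b = B"
    "c \<in> Arr X" "Dom X c = C" "Cod X c = A \<otimes> B" using * by simp_all
  have [simp]: "h \<in> Arr X" "Dom X h = C" "Cod X h = classical_prod X A B" using h by simp_all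
  have "\<rho> x \<cdot> f = (\<rho> x \<cdot> h) \<cdot> classical_proj0 X A B"
    "\<rho> x \<cdot> g = (\<rho> x \<cdot> h) \<cdot> classical_proj1 X A B"
    if "x \<in> Arr X" "Dom X x = C" for x
    unfolding f[symmetric] g[symmetric] using that by simp_all
  note this[of a] this[of b] this[of c]
  then show thesis
    by (intro that[of a b c])
      (use * in \<open>simp_all add: classical_proj0_def classical_proj1_def copairing3_def\<close>)
qed

text \<open>
  Every piece of \<open>h\<close> is visible under one of the projections, so \<open>h\<close> is defined only where one of
  them is. Accordingly the hypotheses say that \<open>k\<close> is defined wherever a projection of \<open>h\<close> is.
\<close>

lemma classical_projections_detect_domain:
  assumes Y: "A \<in> Ob X" "B \<in> Ob X" and h: "h \<in> hom X C (classical_prod X A B)"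
    and k: "k \<in> hom X C D"
    and 0: "\<rho> (h \<cdot> classical_proj0 X A B) \<cdot> \<rho> k = \<rho> (h \<cdot> classical_proj0 X A B)"
    and 1: "\<rho> (h \<cdot> classical_proj1 X A B) \<cdot> \<rho> k = \<rho> (h \<cdot> classical_proj1 X A B)"
  shows "\<rho> h \<cdot> \<rho> k = \<rho> h"
proof -
  define f where "f = h \<cdot> classical_proj0 X A B"
  define g where "g = h \<cdot> classical_proj1 X A B"
  have [simp]: "h \<in> Arr X" "Dom X h = C" "Cod X h = classical_prod X A B" using h by simp_all
  have [simp]: "k \<in> Arr X" "Dom X k = C" using k by simp_all
  have [simp]: "f \<in> Arr X" "Dom X f = C" "g \<in> Arr X" "Dom X g = C" using Y by (simp_all add: f_def g_def)
  obtain a b c where abc: "a \<in> hom X C A" "b \<in> hom X C B" "c \<in> hom X C (A \<otimes> B)"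
    "covers X {a, b, c} h" "\<rho> a \<cdot> f = a" "\<rho> b \<cdot> g = b" "\<rho> c \<cdot> f = c \<cdot> Proj0 X A B"
    by (rule classical_projections[OF Y h f_def[symmetric] g_def[symmetric]])
  have le: "\<rho> x \<cdot> \<rho> m = \<rho> x"
    if x: "x \<in> {a, b, c}" and m: "m \<in> Arr X" "Dom X m = C" "\<rho> f \<cdot> \<rho> m = \<rho> f" "\<rho> g \<cdot> \<rho> m = \<rho> g"
    for x m
  proof -
    have xA: "x \<in> Arr X" "Dom X x = C" using x abc(1-3) by auto
    have "\<rho> x \<cdot> \<rho> f = \<rho> x \<or> \<rho> x \<cdot> \<rho> g = \<rho> x"
      using x xA abc Y Restr_of_restricted[of a f] Restr_of_restricted[of b g]
        Restr_of_restricted[of c f] by auto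
    then obtain e where "e \<in> {f, g}" and e: "\<rho> x \<cdot> \<rho> e = \<rho> x" by blast
    then have eA: "e \<in> Arr X" "Dom X e = C" "\<rho> e \<cdot> \<rho> m = \<rho> e" using m by auto
    have "\<rho> x \<cdot> \<rho> m = \<rho> x \<cdot> (\<rho> e \<cdot> \<rho> m)" using comp_eq_extend[OF e, of "\<rho> m"] xA eA m by simp
    then show ?thesis using e eA by simp
  qed
  have "\<rho> h \<cdot> \<rho> k = \<rho> h \<cdot> \<rho> h"
  proof (rule coversD[OF abc(4)])
    fix x assume x: "x \<in> {a, b, c}"
    have "\<rho> f \<cdot> \<rho> h = \<rho> f" "\<rho> g \<cdot> \<rho> h = \<rho> g" using Y by (simp_all add: f_def g_def)
    then show "\<rho> x \<cdot> \<rho> k = \<rho> x \<cdot> \<rho> h"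
      using le[OF x, of h] le[OF x, of k] 0 1 by (simp add: f_def g_def)
  qed simp_all
  then show ?thesis by simp
qed

text \<open>
  Cut \<open>h\<close> into pieces \<open>a\<close>, \<open>b\<close>, \<open>c\<close> and \<open>k\<close> into pieces \<open>a'\<close>, \<open>b'\<close>, \<open>c'\<close>. Pieces of different kinds have
  disjoint domains, since whether \<open>f\<close> and \<open>g\<close> are defined differs on them; pieces of the same kind
  agree on the common part of their domains, since both are restrictions of \<open>f\<close>, of \<open>g\<close>, or of the
  pair. So \<open>h\<close> and \<open>k\<close> agree on each of the nine overlaps, hence on the intersection of their domains,
  and by the previous lemma these domains are equal.
\<close>

lemma classical_projections_jointly_monic:
  assumes Y: "A \<in> Ob X" "B \<in> Ob X"
    and h: "h \<in> hom X C (classical_prod X A B)" and k: "k \<in> hom X C (classical_prod X A B)"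
    and 0: "h \<cdot> classical_proj0 X A B = k \<cdot> classical_proj0 X A B"
    and 1: "h \<cdot> classical_proj1 X A B = k \<cdot> classical_proj1 X A B"
  shows "h = k"
proof -
  define f where "f = h \<cdot> classical_proj0 X A B"
  define g where "g = h \<cdot> classical_proj1 X A B"
  let ?iA = "Inj0 X A B \<cdot> Inj0 X (A \<oplus> B) (A \<otimes> B)" and ?iB = "Inj1 X A B \<cdot> Inj0 X (A \<oplus> B) (A \<otimes> B)"
    and ?iP = "Inj1 X (A \<oplus> B) (A \<otimes> B)" and ?z = "zero_arr X C C"
  note Y [simp]
  have [simp]: "h \<in> Arr X" "Dom X h = C" "Cod X h = classical_prod X A B" using h by simp_all
  have [simp]: "k \<in> Arr X" "Dom X k = C" "Cod X k = classical_prod X A B" using k by simp_all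
  have [simp]: "C \<in> Ob X" using Dom_Ob[of h] by simp
  have [simp]: "f \<in> Arr X" "Dom X f = C" "Cod X f = A" "g \<in> Arr X" "Dom X g = C" "Cod X g = B"
    by (simp_all add: f_def g_def)
  obtain a b c where abc: "a \<in> hom X C A" "b \<in> hom X C B" "c \<in> hom X C (A \<otimes> B)"
    "\<rho> a \<cdot> h = a \<cdot> ?iA" "\<rho> b \<cdot> h = b \<cdot> ?iB" "\<rho> c \<cdot> h = c \<cdot> ?iP"
    "covers X {a, b, c} h" "\<rho> a \<cdot> f = a" "\<rho> a \<cdot> g = zero_arr X C B"
    "\<rho> b \<cdot> f = zero_arr X C A" "\<rho> b \<cdot> g = b"
    "\<rho> c \<cdot> f = c \<cdot> Proj0 X A B" "\<rho> c \<cdot> g = c \<cdot> Proj1 X A B"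
    by (rule classical_projections[OF Y h f_def[symmetric] g_def[symmetric]])
  obtain a' b' c' where abc': "a' \<in> hom X C A" "b' \<in> hom X C B" "c' \<in> hom X C (A \<otimes> B)"
    "\<rho> a' \<cdot> k = a' \<cdot> ?iA" "\<rho> b' \<cdot> k = b' \<cdot> ?iB" "\<rho> c' \<cdot> k = c' \<cdot> ?iP"
    "covers X {a', b', c'} k" "\<rho> a' \<cdot> f = a'" "\<rho> a' \<cdot> g = zero_arr X C B"
    "\<rho> b' \<cdot> f = zero_arr X C A" "\<rho> b' \<cdot> g = b'"
    "\<rho> c' \<cdot> f = c' \<cdot> Proj0 X A B" "\<rho> c' \<cdot> g = c' \<cdot> Proj1 X A B"
    by (rule classical_projections[OF Y k 0[symmetric, folded f_def] 1[symmetric, folded g_def]])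
  have [simp]: "a \<in> Arr X" "Dom X a = C" "Cod X a = A" "b \<in> Arr X" "Dom X b = C" "Cod X b = B"
    "c \<in> Arr X" "Dom X c = C" "Cod X c = A \<otimes> B" using abc(1-3) by simp_all
  have [simp]: "a' \<in> Arr X" "Dom X a' = C" "Cod X a' = A" "b' \<in> Arr X" "Dom X b' = C" "Cod X b' = B"
    "c' \<in> Arr X" "Dom X c' = C" "Cod X c' = A \<otimes> B" using abc'(1-3) by simp_all
  have dom: "\<rho> a \<cdot> \<rho> f = \<rho> a" "\<rho> a \<cdot> \<rho> g = ?z" "\<rho> b \<cdot> \<rho> f = ?z" "\<rho> b \<cdot> \<rho> g = \<rho> b"
    "\<rho> c \<cdot> \<rho> f = \<rho> c" "\<rho> c \<cdot> \<rho> g = \<rho> c"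
    using abc(8-13)[THEN Restr_of_restricted] by simp_all
  have dom': "\<rho> a' \<cdot> \<rho> f = \<rho> a'" "\<rho> a' \<cdot> \<rho> g = ?z" "\<rho> b' \<cdot> \<rho> f = ?z" "\<rho> b' \<cdot> \<rho> g = \<rho> b'"
    "\<rho> c' \<cdot> \<rho> f = \<rho> c'" "\<rho> c' \<cdot> \<rho> g = \<rho> c'"
    using abc'(8-13)[THEN Restr_of_restricted] by simp_all
  have disj: "\<rho> a \<cdot> \<rho> b' = ?z" "\<rho> c \<cdot> \<rho> b' = ?z" "\<rho> b \<cdot> \<rho> a' = ?z" "\<rho> c \<cdot> \<rho> a' = ?z"
    "\<rho> a' \<cdot> \<rho> b = ?z" "\<rho> c' \<cdot> \<rho> b = ?z" "\<rho> b' \<cdot> \<rho> a = ?z" "\<rho> c' \<cdot> \<rho> a = ?z"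
    using Restr_disjoint[of a b' f C] Restr_disjoint[of c b' f C]
      Restr_disjoint[of b a' g C] Restr_disjoint[of c a' g C]
      Restr_disjoint[of a' b f C] Restr_disjoint[of c' b f C]
      Restr_disjoint[of b' a g C] Restr_disjoint[of c' a g C] dom dom' by simp_all
  have overlap0: "\<rho> y \<cdot> (\<rho> x \<cdot> h) = \<rho> y \<cdot> (\<rho> x \<cdot> k)"
    if "x \<in> Arr X" "Dom X x = C" "y \<in> Arr X" "Dom X y = C" "\<rho> x \<cdot> \<rho> y = ?z \<or> \<rho> y \<cdot> \<rho> x = ?z" for x y
  proof -
    have "\<rho> y \<cdot> \<rho> x = ?z" using that Restr_commute[of x y] by auto
    from comp_eq_extend[OF this, of h] comp_eq_extend[OF this, of k] show ?thesis using that by simp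
  qed
  have overlap1: "\<rho> y \<cdot> (\<rho> x \<cdot> h) = \<rho> y \<cdot> (\<rho> x \<cdot> k)"
    if [simp]: "x \<in> Arr X" "Dom X x = C" "y \<in> Arr X" "Dom X y = C" "i \<in> Arr X" "Cod X x = Dom X i" "Cod X y = Dom X i"
      and "\<rho> x \<cdot> h = x \<cdot> i" "\<rho> y \<cdot> k = y \<cdot> i" "\<rho> y \<cdot> x = \<rho> x \<cdot> y" for x y i
  proof -
    have "\<rho> y \<cdot> (\<rho> x \<cdot> h) = (\<rho> y \<cdot> x) \<cdot> i" using that(8) by simp
    also have "\<dots> = \<rho> x \<cdot> (\<rho> y \<cdot> k)" using that(9,10) by simp
    finally show ?thesis using Restr_left_commute[of x y k] by simp
  qed
  have aa: "\<rho> a' \<cdot> a = \<rho> a \<cdot> a'" 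
    using Restr_left_commute[of a a' f] abc(8) abc'(8) by simp
  have bb: "\<rho> b' \<cdot> b = \<rho> b \<cdot> b'" 
    using Restr_left_commute[of b b' g] abc(11) abc'(11) by simp
  have cc: "\<rho> c' \<cdot> c = \<rho> c \<cdot> c'"
    by (rule Proj_jointly_monic[of A B _ C])
      (use Restr_left_commute[of c c' f] Restr_left_commute[of c c' g] abc(12,13) abc'(12,13) in simp_all)
  have overlap: "\<rho> y \<cdot> (\<rho> x \<cdot> h) = \<rho> y \<cdot> (\<rho> x \<cdot> k)" if x: "x \<in> {a, b, c}" and y: "y \<in> {a', b', c'}" for x y
  proof -
    consider "x = a" "y = a'" | "x = b" "y = b'" | "x = c" "y = c'" | "\<rho> x \<cdot> \<rho> y = ?z \<or> \<rho> y \<cdot> \<rho> x = ?z"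
      using x y disj by blast
    then show ?thesis
    proof cases
      case 1 then show ?thesis using overlap1[of a a' ?iA] aa abc(4) abc'(4) by simp
    next
      case 2 then show ?thesis using overlap1[of b b' ?iB] bb abc(5) abc'(5) by simp
    next
      case 3 then show ?thesis using overlap1[of c c' ?iP] cc abc(6) abc'(6) by simp
    next
      case 4 show ?thesis by (rule overlap0) (use 4 x y in auto)
    qed
  qed
  have "\<rho> h \<cdot> (\<rho> k \<cdot> h) = \<rho> h \<cdot> k"
  proof (rule coversD[OF abc(7), of _ "classical_prod X A B"])
    fix x assume x: "x \<in> {a, b, c}"
    then have xA: "x \<in> Arr X" "Dom X x = C" by auto
    have "\<rho> k \<cdot> (\<rho> x \<cdot> h) = \<rho> k \<cdot> (\<rho> x \<cdot> k)"
      by (rule coversD[OF abc'(7)]) (use overlap[OF x] xA in simp_all)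
    then show "\<rho> x \<cdot> (\<rho> k \<cdot> h) = \<rho> x \<cdot> k"
      using Restr_left_commute[of k x h] Restr_left_commute[of k x k] xA by simp
  qed simp_all
  then have hk: "\<rho> k \<cdot> h = \<rho> h \<cdot> k" using Restr_left_commute[of h k h] by simp
  have "\<rho> h \<cdot> \<rho> k = \<rho> h"
    by (rule classical_projections_detect_domain[OF Y h k]) (simp_all add: 0 1)
  moreover have "\<rho> k \<cdot> \<rho> h = \<rho> k"
    by (rule classical_projections_detect_domain[OF Y k h]) (simp_all add: 0[symmetric] 1[symmetric])
  ultimately have "\<rho> h = \<rho> k" using Restr_commute[of h k] by simp
  then have "h = \<rho> k \<cdot> h" using Restr_comp[of h] by (simp del: Restr_comp)
  also have "\<dots> = \<rho> k \<cdot> k" unfolding hk \<open>\<rho> h = \<rho> k\<close> ..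
  finally show ?thesis by simp
qed

end


section \<open>Classical products yield joins and complements\<close>

locale distributive_restriction_category_with_classical_products =
  distributive_restriction_category_with_zeroes X
  for X :: "('o, 'm, 'x) distributive_structure_scheme" (structure) +
  assumes classical_product: "A \<in> Ob X \<Longrightarrow> B \<in> Ob X \<Longrightarrow>
    is_product X A B (classical_prod X A B) (classical_proj0 X A B) (classical_proj1 X A B)"
begin

lemma classical_pairing:
  assumes "f \<in> hom X C A" "g \<in> hom X C B"
  obtains h where "h \<in> hom X C (classical_prod X A B)"
    "h \<cdot> classical_proj0 X A B = f" "h \<cdot> classical_proj1 X A B = g"
proof -
  have "A \<in> Ob X" "B \<in> Ob X" "C \<in> Ob X" using assms Dom_Ob[of f] Cod_Ob[of f] Cod_Ob[of g] by simp_all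
  then show thesis using classical_product[of A B] assms that unfolding is_product_def by metis
qed

text \<open>
  On the domains of \<open>a\<close>, \<open>b\<close>, \<open>c\<close> the map \<open>h \<cdot> [1, 1, \<pi>\<^sub>0]\<close> equals \<open>f\<close>, \<open>g\<close> and \<open>f\<close> respectively.
  Compatibility says that the choice of \<open>\<pi>\<^sub>0\<close> on the third piece is immaterial: there \<open>f = g\<close>.
  Each piece lies in the domain of \<open>f\<close> or \<open>g\<close>, so these two maps cover.
\<close>

lemma merge_is_join:
  assumes f: "f \<in> hom X A B" and g: "g \<in> hom X A B" and compat: "compatible X f g"
    and h: "h \<in> hom X A (classical_prod X B B)"
    and hf: "h \<cdot> classical_proj0 X B B = f" and hg: "h \<cdot> classical_proj1 X B B = g"
  shows "is_join X A B {f, g} (h \<cdot> copairing3 X (\<one> B) (\<one> B) (Proj0 X B B))"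
proof -
  have [simp]: "f \<in> Arr X" "Dom X f = A" "Cod X f = B" "g \<in> Arr X" "Dom X g = A" "Cod X g = B"
    using f g by simp_all
  have [simp]: "A \<in> Ob X" and B [simp]: "B \<in> Ob X" using Dom_Ob[of f] Cod_Ob[of f] by simp_all
  let ?m = "copairing3 X (\<one> B) (\<one> B) (Proj0 X B B)"
  have [simp]: "h \<in> Arr X" "Dom X h = A" "Cod X h = (B \<oplus> B) \<oplus> (B \<otimes> B)"
    using h by (simp_all add: classical_prod_def)
  have [simp]: "?m \<in> Arr X" "Dom X ?m = (B \<oplus> B) \<oplus> (B \<otimes> B)" "Cod X ?m = B"
    by (simp_all add: copairing3_def)
  define s where "s = h \<cdot> ?m"
  have [simp]: "s \<in> Arr X" "Dom X s = A" "Cod X s = B" by (simp_all add: s_def)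
  obtain a b c where abc: "a \<in> hom X A B" "b \<in> hom X A B" "c \<in> hom X A (B \<otimes> B)"
    "\<rho> a \<cdot> h = a \<cdot> (Inj0 X B B \<cdot> Inj0 X (B \<oplus> B) (B \<otimes> B))"
    "\<rho> b \<cdot> h = b \<cdot> (Inj1 X B B \<cdot> Inj0 X (B \<oplus> B) (B \<otimes> B))"
    "\<rho> c \<cdot> h = c \<cdot> Inj1 X (B \<oplus> B) (B \<otimes> B)"
    "covers X {a, b, c} h"
    "\<rho> a \<cdot> f = a" "\<rho> a \<cdot> g = zero_arr X A B"
    "\<rho> b \<cdot> f = zero_arr X A B" "\<rho> b \<cdot> g = b"
    "\<rho> c \<cdot> f = c \<cdot> Proj0 X B B" "\<rho> c \<cdot> g = c \<cdot> Proj1 X B B"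
    by (rule classical_projections[OF B B h hf hg])
  have [simp]: "a \<in> Arr X" "Dom X a = A" "Cod X a = B" "b \<in> Arr X" "Dom X b = A" "Cod X b = B"
    "c \<in> Arr X" "Dom X c = A" "Cod X c = B \<otimes> B" using abc(1-3) by simp_all
  let ?z = "zero_arr X A A"
  have dom: "\<rho> a \<cdot> \<rho> f = \<rho> a" "\<rho> a \<cdot> \<rho> g = ?z" "\<rho> b \<cdot> \<rho> f = ?z" "\<rho> b \<cdot> \<rho> g = \<rho> b"
    "\<rho> c \<cdot> \<rho> f = \<rho> c" "\<rho> c \<cdot> \<rho> g = \<rho> c"
    using abc(8-13)[THEN Restr_of_restricted] by simp_all
  have restrict_s: "\<rho> x \<cdot> s = (\<rho> x \<cdot> h) \<cdot> ?m" if "x \<in> Arr X" "Dom X x = A" for x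
    using that by (simp add: s_def)
  have as: "\<rho> a \<cdot> s = a" and bs: "\<rho> b \<cdot> s = b" and cs: "\<rho> c \<cdot> s = c \<cdot> Proj0 X B B"
    using restrict_s[of a] restrict_s[of b] restrict_s[of c] abc(4-6)
    by (simp_all add: copairing3_def)
  have cfg: "\<rho> c \<cdot> f = \<rho> c \<cdot> g"
  proof -
    have "\<rho> c \<cdot> f = \<rho> c \<cdot> (\<rho> g \<cdot> f)" using comp_eq_extend[OF dom(6), of f] by simp
    also have "\<dots> = \<rho> c \<cdot> (\<rho> f \<cdot> g)" using compat by (simp add: compatible_def)
    also have "\<dots> = \<rho> c \<cdot> g" using comp_eq_extend[OF dom(5), of g] by simp
    finally show ?thesis .
  qed
  have fh: "\<rho> f \<cdot> \<rho> h = \<rho> f" and gh: "\<rho> g \<cdot> \<rho> h = \<rho> g"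
    unfolding hf[symmetric] hg[symmetric] using h by simp_all
  have upper_f: "restr_le X f s"
  proof -
    have "\<rho> h \<cdot> (\<rho> f \<cdot> s) = \<rho> h \<cdot> f"
    proof (rule coversD[OF abc(7), of _ B])
      fix x assume "x \<in> {a, b, c}"
      then show "\<rho> x \<cdot> (\<rho> f \<cdot> s) = \<rho> x \<cdot> f"
        using comp_eq_extend[OF dom(1), of s] comp_eq_extend[OF dom(3), of s]
          comp_eq_extend[OF dom(5), of s] as cs abc(8,10,12) by auto
    qed simp_all
    then show ?thesis
      using comp_eq_extend[OF fh, of s] comp_eq_extend[OF fh, of f]
        Restr_left_commute[of h f s] Restr_left_commute[of h f f]
      by (simp add: restr_le_def)
  qed
  have upper_g: "restr_le X g s"
  proof -
    have "\<rho> h \<cdot> (\<rho> g \<cdot> s) = \<rho> h \<cdot> g"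
    proof (rule coversD[OF abc(7), of _ B])
      fix x assume "x \<in> {a, b, c}"
      then show "\<rho> x \<cdot> (\<rho> g \<cdot> s) = \<rho> x \<cdot> g"
        using comp_eq_extend[OF dom(2), of s] comp_eq_extend[OF dom(4), of s]
          comp_eq_extend[OF dom(6), of s] bs cs abc(9,11,12) cfg by auto
    qed simp_all
    then show ?thesis
      using comp_eq_extend[OF gh, of s] comp_eq_extend[OF gh, of g]
        Restr_left_commute[of h g s] Restr_left_commute[of h g g]
      by (simp add: restr_le_def)
  qed
  have "covers X {f, g} s"
  proof (rule coversI)
    fix D u v assume "u \<in> hom X (Dom X s) D" "v \<in> hom X (Dom X s) D"
    then have [simp]: "u \<in> Arr X" "Dom X u = A" "Cod X u = D" "v \<in> Arr X" "Dom X v = A" "Cod X v = D"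
      by simp_all
    assume "\<And>e. e \<in> {f, g} \<Longrightarrow> \<rho> e \<cdot> u = \<rho> e \<cdot> v"
    then have eq: "\<rho> f \<cdot> u = \<rho> f \<cdot> v" "\<rho> g \<cdot> u = \<rho> g \<cdot> v" by simp_all
    have "\<rho> h \<cdot> u = \<rho> h \<cdot> v"
    proof (rule coversD[OF abc(7), of _ D])
      fix x assume "x \<in> {a, b, c}"
      then show "\<rho> x \<cdot> u = \<rho> x \<cdot> v"
        using comp_eq_extend[OF dom(1), of u] comp_eq_extend[OF dom(4), of u]
          comp_eq_extend[OF dom(5), of u] comp_eq_extend[OF dom(1), of v]
          comp_eq_extend[OF dom(4), of v] comp_eq_extend[OF dom(5), of v] eq by auto
    qed simp_all
    moreover have sh: "\<rho> s \<cdot> \<rho> h = \<rho> s" unfolding s_def by simp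
    ultimately show "\<rho> s \<cdot> u = \<rho> s \<cdot> v"
      using comp_eq_extend[OF sh, of u] comp_eq_extend[OF sh, of v] by simp
  qed
  then show ?thesis
    unfolding s_def[symmetric] using join_if_covers[of s A B "{f, g}"] upper_f upper_g by auto
qed

text \<open>
  For every \<open>x\<close>, the map \<open>x \<cdot> h\<close> is the pairing of \<open>x \<cdot> f\<close> and \<open>x \<cdot> g\<close>, so the join computed from it is
  \<open>x\<close> followed by the join of \<open>f\<close> and \<open>g\<close>.
\<close>

lemma stable_binary_join:
  assumes f: "f \<in> hom X A B" and g: "g \<in> hom X A B" and compat: "compatible X f g"
  obtains s where "is_join X A B {f, g} s"
    "\<forall>C. \<forall>x \<in> hom X C A. is_join X C B {x \<cdot> f, x \<cdot> g} (x \<cdot> s)"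
proof -
  let ?m = "copairing3 X (\<one> B) (\<one> B) (Proj0 X B B)"
  obtain h where h: "h \<in> hom X A (classical_prod X B B)"
    "h \<cdot> classical_proj0 X B B = f" "h \<cdot> classical_proj1 X B B = g"
    by (rule classical_pairing[OF f g])
  have B: "B \<in> Ob X" using f Cod_Ob[of f] by simp
  have "is_join X C B {x \<cdot> f, x \<cdot> g} (x \<cdot> (h \<cdot> ?m))" if x: "x \<in> hom X C A" for C x
  proof -
    have "is_join X C B {x \<cdot> f, x \<cdot> g} ((x \<cdot> h) \<cdot> ?m)"
      by (rule merge_is_join[OF _ _ compatible_precomp[OF f g compat x]])
        (use x f g h B in simp_all)
    moreover have "(x \<cdot> h) \<cdot> ?m = x \<cdot> (h \<cdot> ?m)"
      using x h(1) B by (simp add: classical_prod_def copairing3_def)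
    ultimately show ?thesis by simp
  qed
  with merge_is_join[OF f g compat h] show thesis using that by blast
qed

text \<open>
  Stability is carried through the induction because it is also what makes the step possible: the
  join \<open>j\<close> of \<open>F\<close> is compatible with \<open>f\<close> since \<open>\<rho> f \<cdot> j\<close> is the join of the maps
  \<open>\<rho> f \<cdot> g = \<rho> g \<cdot> f\<close>, all of which lie below \<open>f\<close>.
\<close>

lemma stable_finite_join:
  assumes A: "A \<in> Ob X" and B: "B \<in> Ob X" and "finite F"
    and F: "F \<subseteq> hom X A B" and compat: "\<And>f g. f \<in> F \<Longrightarrow> g \<in> F \<Longrightarrow> compatible X f g"
  shows "\<exists>j. is_join X A B F j \<and>
    (\<forall>C. \<forall>x \<in> hom X C A. is_join X C B ((\<lambda>f. x \<cdot> f) ` F) (x \<cdot> j))"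
  using \<open>finite F\<close> F compat
proof (induction F rule: finite_induct)
  case empty
  have zero_join: "is_join X C B {} (zero_arr X C B)" if C: "C \<in> Ob X" for C
  proof -
    have "restr_le X (zero_arr X C B) k" if "k \<in> hom X C B" for k
      using that B C by (simp add: restr_le_def)
    then show ?thesis using B C by (auto simp: is_join_def)
  qed
  have "is_join X C B {} (x \<cdot> zero_arr X A B)" if x: "x \<in> hom X C A" for C x
    using zero_join[of C] x B Dom_Ob[of x] by simp
  then show ?case using zero_join[OF A] by auto
next
  case (insert f F)
  obtain j where j: "is_join X A B F j"
    "\<forall>C. \<forall>x \<in> hom X C A. is_join X C B ((\<lambda>f. x \<cdot> f) ` F) (x \<cdot> j)"
    using insert.IH insert.prems by auto
  have f: "f \<in> hom X A B" and FA: "F \<subseteq> hom X A B" using insert.prems by auto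
  have jA: "j \<in> hom X A B" using join_typing[OF j(1)] by simp
  have fA: "f \<in> Arr X" "Dom X f = A" "Cod X f = B" using f by simp_all
  have "is_join X A B ((\<lambda>g. \<rho> f \<cdot> g) ` F) (\<rho> f \<cdot> j)" using j(2) fA by simp
  then have "restr_le X (\<rho> f \<cdot> j) f"
  proof (rule join_least[OF _ f])
    fix k assume "k \<in> (\<lambda>g. \<rho> f \<cdot> g) ` F"
    then obtain g where g: "g \<in> F" "k = \<rho> f \<cdot> g" by blast
    then have gA: "g \<in> Arr X" "Dom X g = A" using FA by auto
    have "compatible X f g" using insert.prems(2) g by simp
    then have "k = \<rho> g \<cdot> f" using g by (simp add: compatible_def)
    then show "restr_le X k f" using restr_le_restrict gA fA by simp
  qed
  then have "compatible X f j"
    using fA jA Restr_commute[of f j] by (simp add: restr_le_def compatible_def Restr_left_commute[of f j f])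
  then obtain s where s: "is_join X A B {f, j} s"
    "\<forall>C. \<forall>x \<in> hom X C A. is_join X C B {x \<cdot> f, x \<cdot> j} (x \<cdot> s)"
    using stable_binary_join[OF f jA] by blast
  have "is_join X C B ((\<lambda>f. x \<cdot> f) ` insert f F) (x \<cdot> s)" if x: "x \<in> hom X C A" for C x
    unfolding image_insert
  proof (rule join_insert)
    show "insert (x \<cdot> f) ((\<lambda>f. x \<cdot> f) ` F) \<subseteq> hom X C B" using x fA FA by auto
  qed (use x j(2) s(2) in blast)+
  moreover have "is_join X A B (insert f F) s"
    by (rule join_insert[OF _ j(1) s(1)]) (use f FA in blast)
  ultimately show ?case by blast
qed

text \<open>
  In the pairing of \<open>g\<close> and \<open>f\<close>, in this order, the first piece is \<open>g\<close> where \<open>f\<close> is undefined, and the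
  other two pieces lie in the domain of \<open>f\<close>.
\<close>

lemma relative_complement_exists:
  assumes f: "f \<in> hom X A B" and g: "g \<in> hom X A B" and le: "restr_le X f g"
  shows "\<exists>d \<in> hom X A B. disjoint_arr X d f \<and> is_join X A B {d, f} g"
proof -
  have [simp]: "f \<in> Arr X" "Dom X f = A" "Cod X f = B" "g \<in> Arr X" "Dom X g = A" "Cod X g = B"
    using f g by simp_all
  have [simp]: "A \<in> Ob X" and B [simp]: "B \<in> Ob X" using Dom_Ob[of f] Cod_Ob[of f] by simp_all
  obtain h where h: "h \<in> hom X A (classical_prod X B B)"
    and hg: "h \<cdot> classical_proj0 X B B = g" and hf: "h \<cdot> classical_proj1 X B B = f"
    by (rule classical_pairing[OF g f])
  have [simp]: "h \<in> Arr X" "Dom X h = A" using h by simp_all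
  obtain a b c where abc: "a \<in> hom X A B" "b \<in> hom X A B" "c \<in> hom X A (B \<otimes> B)"
    "covers X {a, b, c} h"
    "\<rho> a \<cdot> g = a" "\<rho> a \<cdot> f = zero_arr X A B"
    "\<rho> b \<cdot> f = b" "\<rho> c \<cdot> f = c \<cdot> Proj1 X B B"
    by (rule classical_projections[OF B B h hg hf])
  have [simp]: "a \<in> Arr X" "Dom X a = A" "Cod X a = B" "b \<in> Arr X" "Dom X b = A" "Cod X b = B"
    "c \<in> Arr X" "Dom X c = A" "Cod X c = B \<otimes> B" using abc(1-3) by simp_all
  have dom: "\<rho> b \<cdot> \<rho> f = \<rho> b" "\<rho> c \<cdot> \<rho> f = \<rho> c"
    using abc(7,8)[THEN Restr_of_restricted] by simp_all
  have gh: "\<rho> g \<cdot> \<rho> h = \<rho> g" unfolding hg[symmetric] using h by simp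
  have "covers X {a, f} g"
  proof (rule coversI)
    fix D u v assume "u \<in> hom X (Dom X g) D" "v \<in> hom X (Dom X g) D"
    then have [simp]: "u \<in> Arr X" "Dom X u = A" "Cod X u = D" "v \<in> Arr X" "Dom X v = A" "Cod X v = D"
      by simp_all
    assume "\<And>e. e \<in> {a, f} \<Longrightarrow> \<rho> e \<cdot> u = \<rho> e \<cdot> v"
    then have eq: "\<rho> a \<cdot> u = \<rho> a \<cdot> v" "\<rho> f \<cdot> u = \<rho> f \<cdot> v" by simp_all
    have "\<rho> h \<cdot> u = \<rho> h \<cdot> v"
    proof (rule coversD[OF abc(4), of _ D])
      fix x assume "x \<in> {a, b, c}"
      then show "\<rho> x \<cdot> u = \<rho> x \<cdot> v"
        using comp_eq_extend[OF dom(1), of u] comp_eq_extend[OF dom(2), of u]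
          comp_eq_extend[OF dom(1), of v] comp_eq_extend[OF dom(2), of v] eq by auto
    qed simp_all
    then show "\<rho> g \<cdot> u = \<rho> g \<cdot> v"
      using comp_eq_extend[OF gh, of u] comp_eq_extend[OF gh, of v] by simp
  qed
  then have "is_join X A B {a, f} g"
    using join_if_covers[of g A B "{a, f}"] le abc(5) by (auto simp: restr_le_def)
  moreover have "disjoint_arr X a f" using abc(6) by (simp add: disjoint_arr_def)
  ultimately show ?thesis using abc(1) by blast
qed

lemma is_classical: "classical_restriction_category X"
proof unfold_locales
  fix A B F assume *: "A \<in> Ob X" "B \<in> Ob X" "F \<subseteq> hom X A B" "finite F"
    "\<And>f g. f \<in> F \<Longrightarrow> g \<in> F \<Longrightarrow> compatible X f g"
  obtain k where k: "is_join X A B F k"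
    "\<forall>C. \<forall>x \<in> hom X C A. is_join X C B ((\<lambda>f. x \<cdot> f) ` F) (x \<cdot> k)"
    using stable_finite_join[OF *(1,2,4,3,5)] by blast
  then show "\<exists>j. is_join X A B F j" by blast
  fix j h C assume "is_join X A B F j" and "h \<in> hom X C A"
  then show "is_join X C B ((\<lambda>f. h \<cdot> f) ` F) (h \<cdot> j)" using k join_unique by blast
qed (rule relative_complement_exists)

end

section \<open>Complements and joins yield classical products\<close>

locale classical_distributive_restriction_category =
  distributive_restriction_category X + classical_restriction_category X
  for X :: "('o, 'm, 'x) distributive_structure_scheme" (structure)
begin

sublocale distributive_restriction_category_with_zeroes
  by unfold_locales (rule empty_joins_are_zeroes)

text \<open>
  The complement \<open>a\<close> of \<open>\<rho> g \<cdot> f\<close> in \<open>f\<close>, the complement \<open>b\<close> of \<open>\<rho> f \<cdot> g\<close> in \<open>g\<close>, and \<open>\<langle>f, g\<rangle>\<close> have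
  pairwise disjoint domains, so the maps \<open>\<alpha>\<close>, \<open>\<beta>\<close>, \<open>\<gamma>\<close> into the three summands have a join \<open>j\<close>. As \<open>j\<close> is
  covered by them, \<open>j \<cdot> p\<^sub>0\<close> is the restriction of \<open>f\<close> to the domain of \<open>j\<close>; and as \<open>f\<close> is covered by
  \<open>a\<close> and \<open>\<rho> g \<cdot> f\<close>, whose domains lie in that of \<open>j\<close>, this restriction is all of \<open>f\<close>. Likewise for \<open>g\<close>.
\<close>

lemma classical_pairing_exists:
  assumes f: "f \<in> hom X C A" and g: "g \<in> hom X C B"
  shows "\<exists>h. h \<in> hom X C (classical_prod X A B) \<and>
    h \<cdot> classical_proj0 X A B = f \<and> h \<cdot> classical_proj1 X A B = g"
proof -
  have [simp]: "f \<in> Arr X" "Dom X f = C" "Cod X f = A" "g \<in> Arr X" "Dom X g = C" "Cod X g = B"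
    using f g by simp_all
  have Ob [simp]: "A \<in> Ob X" "B \<in> Ob X" "C \<in> Ob X"
    using Dom_Ob[of f] Cod_Ob[of f] Cod_Ob[of g] by simp_all
  let ?z = "zero_arr X C C"
  let ?iA = "Inj0 X A B \<cdot> Inj0 X (A \<oplus> B) (A \<otimes> B)" and ?iB = "Inj1 X A B \<cdot> Inj0 X (A \<oplus> B) (A \<otimes> B)"
    and ?iP = "Inj1 X (A \<oplus> B) (A \<otimes> B)"
  obtain a where a: "a \<in> hom X C A" "disjoint_arr X a (\<rho> g \<cdot> f)" "is_join X C A {a, \<rho> g \<cdot> f} f"
    using relative_complement[of "\<rho> g \<cdot> f" C A f] restr_le_restrict[of g f] by auto
  obtain b where b: "b \<in> hom X C B" "disjoint_arr X b (\<rho> f \<cdot> g)" "is_join X C B {b, \<rho> f \<cdot> g} g"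
    using relative_complement[of "\<rho> f \<cdot> g" C B g] restr_le_restrict[of f g] by auto
  define c where "c = pairing X f g"
  have [simp]: "a \<in> Arr X" "Dom X a = C" "Cod X a = A" "b \<in> Arr X" "Dom X b = C" "Cod X b = B"
    "c \<in> Arr X" "Dom X c = C" "Cod X c = A \<otimes> B" using a(1) b(1) by (simp_all add: c_def)
  have cp: "c \<cdot> Proj0 X A B = \<rho> g \<cdot> f" "c \<cdot> Proj1 X A B = \<rho> f \<cdot> g" by (simp_all add: c_def)
  have c_dom: "\<rho> c = \<rho> f \<cdot> \<rho> g"
    using Restr_comp_Proj(1)[of c A B] cp Restr_commute[of f g] by simp
  have af: "\<rho> a \<cdot> f = a" and bg: "\<rho> b \<cdot> g = b"
    using join_upper[OF a(3)] join_upper[OF b(3)] by (simp_all add: restr_le_def)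
  have dom1: "\<rho> a \<cdot> \<rho> f = \<rho> a" "\<rho> b \<cdot> \<rho> g = \<rho> b"
    using Restr_of_restricted[OF af] Restr_of_restricted[OF bg] by simp_all
  have dom2: "\<rho> a \<cdot> \<rho> g = ?z"
  proof -
    have "\<rho> a \<cdot> (\<rho> g \<cdot> f) = zero_arr X C A" using a(2) by (simp add: disjoint_arr_def)
    then have "\<rho> a \<cdot> (\<rho> g \<cdot> \<rho> f) = ?z" using Restr_of_restricted[of a "\<rho> g \<cdot> f"] by simp
    then show ?thesis using dom1(1) Restr_commute[of g f] comp_eq_extend[OF dom1(1), of "\<rho> g"] by simp
  qed
  have dom3: "\<rho> b \<cdot> \<rho> f = ?z"
  proof -
    have "\<rho> b \<cdot> (\<rho> f \<cdot> g) = zero_arr X C B" using b(2) by (simp add: disjoint_arr_def)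
    then have "\<rho> b \<cdot> (\<rho> f \<cdot> \<rho> g) = ?z" using Restr_of_restricted[of b "\<rho> f \<cdot> g"] by simp
    then show ?thesis using dom1(2) Restr_commute[of f g] comp_eq_extend[OF dom1(2), of "\<rho> f"] by simp
  qed
  have dom4: "\<rho> c \<cdot> \<rho> f = \<rho> c" "\<rho> c \<cdot> \<rho> g = \<rho> c"
    unfolding c_dom using Restr_commute[of f g] by simp_all
  have disj: "\<rho> a \<cdot> \<rho> b = ?z" "\<rho> b \<cdot> \<rho> a = ?z" "\<rho> a \<cdot> \<rho> c = ?z" "\<rho> c \<cdot> \<rho> a = ?z"
    "\<rho> b \<cdot> \<rho> c = ?z" "\<rho> c \<cdot> \<rho> b = ?z"
    using Restr_disjoint[of a b f C] Restr_disjoint[of b a g C] Restr_disjoint[of c a g C]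
      Restr_disjoint[of c b f C] Restr_commute[of a c] Restr_commute[of b c] dom1 dom2 dom3 dom4
    by simp_all
  define \<alpha> where "\<alpha> = a \<cdot> ?iA"
  define \<beta> where "\<beta> = b \<cdot> ?iB"
  define \<gamma> where "\<gamma> = c \<cdot> ?iP"
  let ?P = "classical_prod X A B" and ?F = "{\<alpha>, \<beta>, \<gamma>}"
  have [simp]: "?P \<in> Ob X" "\<alpha> \<in> Arr X" "Dom X \<alpha> = C" "Cod X \<alpha> = ?P" "\<beta> \<in> Arr X" "Dom X \<beta> = C" "Cod X \<beta> = ?P"
    "\<gamma> \<in> Arr X" "Dom X \<gamma> = C" "Cod X \<gamma> = ?P"
    by (simp_all add: \<alpha>_def \<beta>_def \<gamma>_def classical_prod_def)
  have "\<rho> ((a \<cdot> Inj0 X A B) \<cdot> Inj0 X (A \<oplus> B) (A \<otimes> B)) = \<rho> a"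
    "\<rho> ((b \<cdot> Inj1 X A B) \<cdot> Inj0 X (A \<oplus> B) (A \<otimes> B)) = \<rho> b"
    by (simp_all del: comp_assoc)
  then have Restr_F: "\<rho> \<alpha> = \<rho> a" "\<rho> \<beta> = \<rho> b" "\<rho> \<gamma> = \<rho> c"
    by (simp_all add: \<alpha>_def \<beta>_def \<gamma>_def)
  have proj: "\<alpha> \<cdot> classical_proj0 X A B = a" "\<alpha> \<cdot> classical_proj1 X A B = zero_arr X C B"
    "\<beta> \<cdot> classical_proj0 X A B = zero_arr X C A" "\<beta> \<cdot> classical_proj1 X A B = b"
    "\<gamma> \<cdot> classical_proj0 X A B = \<rho> g \<cdot> f" "\<gamma> \<cdot> classical_proj1 X A B = \<rho> f \<cdot> g"
    unfolding cp[symmetric]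
    by (simp_all add: \<alpha>_def \<beta>_def \<gamma>_def classical_proj0_def classical_proj1_def copairing3_def)
  have zero: "\<rho> x \<cdot> y = zero_arr X C ?P"
    if "\<rho> x \<cdot> \<rho> y = ?z" "x \<in> Arr X" "Dom X x = C" "y \<in> hom X C ?P" for x y
  proof -
    have "\<rho> x \<cdot> y = (\<rho> x \<cdot> \<rho> y) \<cdot> y" using that(2-4) by simp
    also have "\<dots> = zero_arr X C ?P" unfolding that(1) using that(4) by simp
    finally show ?thesis .
  qed
  have F: "?F \<subseteq> hom X C ?P" "finite ?F" by auto
  have compat: "compatible X x y" if "x \<in> ?F" "y \<in> ?F" for x y
  proof (cases "x = y")
    case False
    then have "\<rho> x \<cdot> \<rho> y = ?z" "\<rho> y \<cdot> \<rho> x = ?z" using that disj Restr_F by auto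
    then show ?thesis using zero[of x y] zero[of y x] that by (auto simp: compatible_def)
  qed (simp add: compatible_def)
  obtain j where j: "is_join X C ?P ?F j" using join_exists[OF _ _ F compat] by auto
  have [simp]: "j \<in> Arr X" "Dom X j = C" "Cod X j = ?P" using join_typing[OF j] by simp_all
  have cov: "covers X ?F j" by (rule join_covers[OF _ _ F compat j]) simp_all
  have below: "\<rho> x \<cdot> j = x" "\<rho> x \<cdot> \<rho> j = \<rho> x" if "x \<in> ?F" for x
    using join_upper[OF j that] restr_le_Restr[of x j] that by (auto simp: restr_le_def)
  have upper: "\<rho> a \<cdot> j = \<alpha>" "\<rho> b \<cdot> j = \<beta>" "\<rho> c \<cdot> j = \<gamma>"
    "\<rho> a \<cdot> \<rho> j = \<rho> a" "\<rho> b \<cdot> \<rho> j = \<rho> b" "\<rho> c \<cdot> \<rho> j = \<rho> c"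
    using below[of \<alpha>] below[of \<beta>] below[of \<gamma>] Restr_F by simp_all
  have f_covered: "\<rho> f \<cdot> f = \<rho> f \<cdot> (\<rho> j \<cdot> f)"
  proof (rule coversD[of "{a, \<rho> g \<cdot> f}"])
    show "covers X {a, \<rho> g \<cdot> f} f"
      by (rule join_covers[OF _ _ _ _ _ a(3)])
        (use compatible_if_bounded[of _ C A _ f] join_upper[OF a(3)] in auto)
    fix x assume "x \<in> {a, \<rho> g \<cdot> f}"
    then have "\<rho> x = \<rho> a \<or> \<rho> x = \<rho> c" using c_dom Restr_commute[of f g] by auto
    then show "\<rho> x \<cdot> f = \<rho> x \<cdot> (\<rho> j \<cdot> f)"
      using comp_eq_extend[OF upper(4), of f] comp_eq_extend[OF upper(6), of f] by auto
  qed simp_all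
  have g_covered: "\<rho> g \<cdot> g = \<rho> g \<cdot> (\<rho> j \<cdot> g)"
  proof (rule coversD[of "{b, \<rho> f \<cdot> g}"])
    show "covers X {b, \<rho> f \<cdot> g} g"
      by (rule join_covers[OF _ _ _ _ _ b(3)])
        (use compatible_if_bounded[of _ C B _ g] join_upper[OF b(3)] in auto)
    fix x assume "x \<in> {b, \<rho> f \<cdot> g}"
    then have "\<rho> x = \<rho> b \<or> \<rho> x = \<rho> c" using c_dom by auto
    then show "\<rho> x \<cdot> g = \<rho> x \<cdot> (\<rho> j \<cdot> g)"
      using comp_eq_extend[OF upper(5), of g] comp_eq_extend[OF upper(6), of g] by auto
  qed simp_all
  have j0: "\<rho> j \<cdot> (j \<cdot> classical_proj0 X A B) = \<rho> j \<cdot> f"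
  proof (rule coversD[OF cov])
    fix x assume x: "x \<in> ?F"
    have "\<rho> x \<cdot> (j \<cdot> classical_proj0 X A B) = x \<cdot> classical_proj0 X A B"
      using comp_eq_extend[OF below(1)[OF x], of "classical_proj0 X A B"] x by auto
    moreover have "\<rho> x \<cdot> f = x \<cdot> classical_proj0 X A B"
      using x af comp_eq_extend[OF dom3, of f] Restr_left_commute[of f g f] by (auto simp: Restr_F proj c_dom)
    ultimately show "\<rho> x \<cdot> (j \<cdot> classical_proj0 X A B) = \<rho> x \<cdot> f" by simp
  qed simp_all
  have j1: "\<rho> j \<cdot> (j \<cdot> classical_proj1 X A B) = \<rho> j \<cdot> g"
  proof (rule coversD[OF cov])
    fix x assume x: "x \<in> ?F"
    have "\<rho> x \<cdot> (j \<cdot> classical_proj1 X A B) = x \<cdot> classical_proj1 X A B"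
      using comp_eq_extend[OF below(1)[OF x], of "classical_proj1 X A B"] x by auto
    moreover have "\<rho> x \<cdot> g = x \<cdot> classical_proj1 X A B"
      using x bg comp_eq_extend[OF dom2, of g] by (auto simp: Restr_F proj c_dom)
    ultimately show "\<rho> x \<cdot> (j \<cdot> classical_proj1 X A B) = \<rho> x \<cdot> g" by simp
  qed simp_all
  have "j \<cdot> classical_proj0 X A B = f" "j \<cdot> classical_proj1 X A B = g"
    using j0 j1 f_covered g_covered Restr_left_commute[of f j f] Restr_left_commute[of g j g] by simp_all
  then show ?thesis by (intro exI[of _ j]) simp
qed

lemma classical_products: "has_classical_products X"
  unfolding has_classical_products_def is_product_def
proof (intro conjI ballI has_zeroes)
  fix A B C f g assume AB: "A \<in> Ob X" "B \<in> Ob X" and fg: "f \<in> hom X C A" "g \<in> hom X C B"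
  show "\<exists>!h. h \<in> hom X C (classical_prod X A B) \<and>
      h \<cdot> classical_proj0 X A B = f \<and> h \<cdot> classical_proj1 X A B = g"
    using classical_pairing_exists[OF fg] classical_projections_jointly_monic[OF AB] by metis
qed simp_all

end

theorem theorem6p8:
  fixes X :: "('o, 'm, 'x) distributive_structure_scheme"
  assumes "distributive_restriction_category X"
  shows "classical_restriction_category X \<longleftrightarrow> has_classical_products X"
proof
  assume "classical_restriction_category X"
  with assms interpret classical_distributive_restriction_category X
    by (simp add: classical_distributive_restriction_category_def)
  show "has_classical_products X" by (rule classical_products)
next
  assume cp: "has_classical_products X"
  interpret distributive_restriction_category X by fact
  interpret distributive_restriction_category_with_classical_products X
    by unfold_locales (use cp in \<open>auto simp: has_classical_products_def\<close>)
  show "classical_restriction_category X" by (rule is_classical)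
qed

end
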